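(* Let $0\le K\le 1$. For all $a\in\mathbb{R}^{n+1}$ with $\|a\|=1$ and $\sum_{j=1}^{n+1}a_j=K$ we have $$\operatorname{vol}_{n-1}(H_a\cap S)\le \frac{\sqrt{n+1-K^2}}{(n-1)!}\,\frac{1}{\sqrt{2-K^2}},$$ with equality for $a=\left(\frac K2+\sqrt{\frac12-\frac{K^2}{4}},\ \frac K2-\sqrt{\frac12-\frac{K^2}{4}},\ 0,\dots,0\right)$.
   Context: $S:=\{x\in\mathbb{R}^{n+1}\mid \sum_{j=1}^{n+1}x_j=1,\ x_j\ge 0\}$ is the regular $n$-simplex embedded in $\mathbb{R}^{n+1}$. $\|\cdot\|$ is the Euclidean norm and $\langle\cdot,\cdot\rangle$ the standard scalar product. $H_a:=\{x\in\mathbb{R}^{n+1}\mid\langle a,x\rangle=0\}$. $\operatorname{vol}_{n-1}$ is the $(n-1)$-dimensional Lebesgue volume within the affine subspace $H_a\cap\{\sum_j x_j=1\}$ containing the section. *)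

theory Defs
  imports "HOL-Analysis.Analysis"
begin

definition hyperplane :: "real ^ 'n \<Rightarrow> (real ^ 'n) set" where
  "hyperplane a = {x. a \<bullet> x = 0}"

definition sum_one :: "(real ^ 'n) set" where
  "sum_one = {x. (\<Sum>j\<in>UNIV. x $ j) = 1}"

definition simplex_S :: "(real ^ 'n) set" where
  "simplex_S = {x. (\<Sum>j\<in>UNIV. x $ j) = 1 \<and> (\<forall>j. x $ j \<ge> 0)}"

definition orthonormal_frame ::
    "nat \<Rightarrow> 'a::euclidean_space set \<Rightarrow> 'a \<Rightarrow> (nat \<Rightarrow> 'a) \<Rightarrow> bool" where
  "orthonormal_frame k E p u \<longleftrightarrow>
     (\<forall>i<k. \<forall>j<k. u i \<bullet> u j = (if i = j then 1 else 0)) \<and>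
     E = range (\<lambda>t::nat \<Rightarrow> real. p + (\<Sum>i<k. t i *\<^sub>R u i))"

(* k-dimensional Lebesgue measure within a k-dimensional affine subspace E of a Euclidean space:
   the image of Lebesgue measure on R^k under an isometric affine parametrisation of E.  The result
   does not depend on the choice of frame, since Lebesgue measure on R^k is invariant under
   isometries.  R^k is represented as the space of extensional functions on {..<k}, which makes
   k a term and covers k = 0 (unit point mass).  Only meaningful if E is affine of dimension k. *)
definition affine_lborel :: "nat \<Rightarrow> 'a::euclidean_space set \<Rightarrow> 'a measure" where
  "affine_lborel k E =
     (let (p, u) = (SOME (p, u). orthonormal_frame k E p u)
      in distr (\<Pi>\<^sub>M i\<in>{..<k}. lborel) borel (\<lambda>t. p + (\<Sum>i<k. t i *\<^sub>R u i)))"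

(* For a not a multiple of (1,...,1), the carrying affine subspace has dimension CARD('n) - 2, which
   is the intended value of k. *)
definition section_vol :: "nat \<Rightarrow> real ^ 'n \<Rightarrow> ennreal" where
  "section_vol k a =
     emeasure (affine_lborel k (hyperplane a \<inter> sum_one)) (hyperplane a \<inter> simplex_S)"

(* The two distinguished coordinates are i and j, the index type carrying no order. *)
definition extremal :: "real \<Rightarrow> 'n \<Rightarrow> 'n \<Rightarrow> real ^ 'n" where
  "extremal K i j =
     (\<chi> l. if l = i then K / 2 + sqrt (1 / 2 - K\<^sup>2 / 4)
           else if l = j then K / 2 - sqrt (1 / 2 - K\<^sup>2 / 4)
           else 0)"

end

theory Submission
  imports Defs "HOL-Probability.Distributions"
begin

text \<open>
  Let \<open>X = (\<Sum>j. a j * E j)\<close> with independent standard exponential variables \<open>E j\<close>, and let \<open>f\<close> be the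
  density of \<open>X\<close>. Its mean is \<open>K\<close> and its second moment is \<open>1 + K\<^sup>2\<close>.

  The joint density of the \<open>E j\<close> is \<open>exp (- r)\<close> on the dilate of the simplex by \<open>r\<close>. Slicing the orthant
  by the two linear forms \<open>a \<bullet> x\<close> and \<open>r = (\<Sum>j. x $ j)\<close>, whose Gram determinant is \<open>n + 1 - K\<^sup>2\<close>, gives
  \<open>f 0 = (n - 1)! * vol / sqrt (n + 1 - K\<^sup>2)\<close>, where \<open>vol\<close> is the volume of the section and the factorial is
  \<open>\<integral> r ^ (n - 1) * exp (- r) dr\<close> (lemma \<open>section_vol_slice\<close>). So the theorem is the inequality
  \<open>f 0 \<le> 1 / sqrt (2 - K\<^sup>2)\<close>.

  As a convolution of exponential densities, \<open>f\<close> is log-concave. Let \<open>g\<close> be the two-sided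
  exponential density, \<open>f 0 * exp (- x / \<alpha>)\<close> on the right and \<open>f 0 * exp (x / \<beta>)\<close> on the left, with the
  same mass and the same mean as \<open>f\<close>. On each half-line \<open>f / g\<close> is log-concave and equals \<open>1\<close> at the origin, so it crosses
  the value \<open>1\<close> at most once, downwards. A quadratic with roots at the two crossings
  then shows that \<open>f\<close> has at most the second moment of \<open>g\<close>. Since \<open>\<alpha> + \<beta> = 1 / f 0\<close> and
  \<open>\<alpha> - \<beta> = K\<close>, this reads \<open>2 * (1 + K\<^sup>2) \<le> (1 / f 0)\<^sup>2 + 3 * K\<^sup>2\<close>, which is the claim (lemmas
  \<open>pf2_second_moment_comparison\<close> and \<open>pf2_density_bound\<close>).

  Equality holds if \<open>f\<close> itself is such a \<open>g\<close>. This happens if \<open>a\<close> has exactly two nonzero coordinates, of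
  opposite signs, and, with a one-sided exponential, for \<open>K = 1\<close> if \<open>a\<close> is a coordinate vector; the extremal vector is of
  this form.
\<close>

section \<open>Log-concavity and crossings with exponentials\<close>

text \<open>
  Log-concavity in two-by-two determinant form: the Toeplitz kernel \<open>f (x - z)\<close> is totally
  positive of order two. In this form closure under convolution follows by symmetrising a
  double integral, and zeros and extended nonnegative values need no special treatment.
\<close>

definition pf2 :: "(real \<Rightarrow> 'a::{times,ord}) \<Rightarrow> bool" where
  "pf2 f \<longleftrightarrow> (\<forall>x1 x2 z1 z2. x1 \<le> x2 \<longrightarrow> z1 \<le> z2 \<longrightarrow>
     f (x1 - z2) * f (x2 - z1) \<le> f (x1 - z1) * f (x2 - z2))"

lemma pf2D:
  assumes "pf2 f" "a \<le> b" "b \<le> d" "a + d = b + c"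
  shows "f a * f d \<le> f b * f c"
proof -
  have *: "\<And>x1 x2 z1 z2. x1 \<le> x2 \<Longrightarrow> z1 \<le> z2 \<Longrightarrow>
     f (x1 - z2) * f (x2 - z1) \<le> f (x1 - z1) * f (x2 - z2)"
    using assms(1) unfolding pf2_def by blast
  have "a \<le> c" using assms by linarith
  from *[of a c "a - b" 0] assms(2) this
  have "f (a - 0) * f (c - (a - b)) \<le> f (a - (a - b)) * f (c - 0)"
    by simp
  moreover have "c - (a - b) = d" using assms(4) by simp
  ultimately show ?thesis by simp
qed

lemma pf2_reflect:
  fixes f :: "real \<Rightarrow> 'a::{ab_semigroup_mult,ord}"
  assumes "pf2 f"
  shows "pf2 (\<lambda>x. f (- x))"
  unfolding pf2_def
proof (intro allI impI)
  fix x1 x2 z1 z2 :: real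
  assume "x1 \<le> x2" "z1 \<le> z2"
  then show "f (- (x1 - z2)) * f (- (x2 - z1)) \<le> f (- (x1 - z1)) * f (- (x2 - z2))"
    using pf2D[OF assms, of "z1 - x2" "z1 - x1" "z2 - x1" "z2 - x2"]
    by (simp add: mult.commute)
qed

text \<open>
  A log-concave function divided by an exponential is log-concave, so once it has dropped
  below its value at the origin it can never return. The determinant form only gives
  midpoint log-concavity, hence continuity is used: at the leftmost interior minimum of the
  quotient the midpoint inequality fails.
\<close>

lemma pf2_crossing:
  fixes f :: "real \<Rightarrow> real"
  assumes pf: "pf2 f" and cont: "continuous_on UNIV f" and nonneg: "\<And>x. 0 \<le> f x"
    and c: "0 < c" "c \<le> f 0"
    and x: "0 < x" "x < y" and fx: "f x < c * exp (- k * x)"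
  shows "f y \<le> c * exp (- k * y)"
proof (rule ccontr)
  assume neg: "\<not> f y \<le> c * exp (- k * y)"
  define h where "h x = f x * exp (k * x)" for x
  have hy: "c < h y" and hx: "h x < c" and h0: "c \<le> h 0"
    using neg fx c by (auto simp: h_def exp_minus field_simps)
  have hpf: "h p * h q \<le> h b * h b'" if "p \<le> b" "b \<le> q" "p + q = b + b'" for p q b b'
  proof -
    have "h p * h q = (f p * f q) * exp (k * (p + q))"
      by (simp add: h_def exp_add ring_distribs)
    also have "\<dots> \<le> (f b * f b') * exp (k * (p + q))"
      using pf2D[OF pf that] by (simp add: mult_right_mono)
    also have "\<dots> = h b * h b'"
      by (simp add: h_def exp_add ring_distribs that(3))
    finally show ?thesis .
  qed
  have hnonneg: "0 \<le> h z" for z using nonneg by (simp add: h_def)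
  \<comment> \<open>Positivity is needed below, since a product of two values is compared with
    the square of the minimum.\<close>
  have hpos: "0 < h z" if "0 \<le> z" "z \<le> y" for z
  proof -
    have "0 < h 0 * h y" using h0 hy c by simp
    also have "\<dots> \<le> h z * h (y - z)" using that by (intro hpf) auto
    finally show ?thesis using hnonneg[of z] by (cases "h z = 0") auto
  qed
  have conth: "continuous_on {0..y} h"
    unfolding h_def by (intro continuous_intros continuous_on_subset[OF cont]) auto
  obtain z0 where z0: "z0 \<in> {0..y}" "\<And>z. z \<in> {0..y} \<Longrightarrow> h z0 \<le> h z"
    using continuous_attains_inf[OF _ _ conth] x by auto
  define Z where "Z = {z \<in> {0..y}. h z = h z0}"
  have "closed Z"
    unfolding Z_def by (rule continuous_closed_preimage_constant[OF conth]) simp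
  then have "compact Z"
    using compact_Int_closed[of "{0..y}" Z] Int_absorb1[of Z "{0..y}"] by (simp add: Z_def subset_iff)
  moreover have "Z \<noteq> {}" using z0 by (auto simp: Z_def)
  \<comment> \<open>The leftmost minimum: to its left the function is strictly larger, which
    contradicts log-concavity at the midpoint.\<close>
  ultimately obtain m where m: "m \<in> Z" "\<And>z. z \<in> Z \<Longrightarrow> m \<le> z"
    using compact_attains_inf[of Z] by auto
  have hm: "h m = h z0" "0 \<le> m" "m \<le> y" using m(1) by (auto simp: Z_def)
  have "h m < c" using z0(2)[of x] hm hx x by auto
  then have "m \<noteq> 0" "m \<noteq> y" using h0 hy by auto
  define d where "d = min m (y - m)"
  have d: "0 < d" "d \<le> m" "m + d \<le> y" using hm \<open>m \<noteq> 0\<close> \<open>m \<noteq> y\<close> by (auto simp: d_def)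
  have "h m < h (m - d)"
    using z0(2)[of "m - d"] m(2)[of "m - d"] hm d by (fastforce simp: Z_def)
  moreover have "h m \<le> h (m + d)" using z0(2)[of "m + d"] hm d by auto
  ultimately have "h m * h m < h (m - d) * h (m + d)"
    using hpos[of m] hm by (intro mult_less_le_imp_less) auto
  moreover have "h (m - d) * h (m + d) \<le> h m * h m"
    using d by (intro hpf) auto
  ultimately show False by simp
qed

text \<open>
  The form in which the single sign change is used: either \<open>f\<close> dominates the exponential on
  the whole half-line, or there is a threshold before which \<open>f\<close> is larger and after which it
  is smaller.
\<close>

lemma pf2_crossing_threshold:
  fixes f :: "real \<Rightarrow> real"
  assumes "pf2 f" "continuous_on UNIV f" "\<And>x. 0 \<le> f x" "0 < c" "c \<le> f 0"
  obtains "\<And>x. 0 \<le> x \<Longrightarrow> c * exp (- k * x) \<le> f x"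
  | t where "0 \<le> t" "\<And>x. 0 \<le> x \<Longrightarrow> x < t \<Longrightarrow> c * exp (- k * x) \<le> f x"
      "\<And>x. t < x \<Longrightarrow> f x \<le> c * exp (- k * x)"
proof (cases "\<exists>x\<ge>0. f x < c * exp (- k * x)")
  case False
  then show ?thesis using that(1) by (meson not_less)
next
  case True
  define B where "B = {x. 0 \<le> x \<and> f x < c * exp (- k * x)}"
  have B: "B \<noteq> {}" "bdd_below B" using True by (auto simp: B_def)
  show ?thesis
  proof (rule that(2)[of "Inf B"])
    show "0 \<le> Inf B" using B by (auto intro!: cInf_greatest simp: B_def)
    show "c * exp (- k * x) \<le> f x" if "0 \<le> x" "x < Inf B" for x
      using that cInf_lower[OF _ B(2), of x] by (force simp: B_def)
    show "f x \<le> c * exp (- k * x)" if less: "Inf B < x" for x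
    proof -
      obtain z where z: "z \<in> B" "z < x" using cInf_lessD[OF B(1) less] by blast
      then have "z \<noteq> 0" using assms by (auto simp: B_def)
      then show ?thesis
        using z by (intro pf2_crossing[OF assms(1,2,3,4,5), of z x k]) (auto simp: B_def)
    qed
  qed
qed

section \<open>A bound for log-concave densities\<close>

lemma exp_power_integral:
  "has_bochner_integral lborel (\<lambda>x::real. x ^ k * (exp (- x) * indicator {0..} x)) (fact k)"
proof (rule has_bochner_integral_nn_integral)
  have "(\<integral>\<^sup>+ x. ennreal (x ^ k * (exp (- x) * indicator {0..} x)) \<partial>lborel)
     = (\<integral>\<^sup>+x. ennreal (x^k * exp (-x)) * indicator {0 ..} x \<partial>lborel)"
    by (intro nn_integral_cong) (auto simp: indicator_def)
  also have "\<dots> = ennreal (fact k)"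
    by (subst nn_intergal_power_times_exp_Ici) simp
  finally show "(\<integral>\<^sup>+ x. ennreal (x ^ k * (exp (- x) * indicator {0..} x)) \<partial>lborel) = ennreal (fact k)" .
qed (measurable, auto simp: indicator_def)

lemma scaled_exp_power_integral:
  fixes l c :: real
  assumes "0 < l"
  shows "has_bochner_integral lborel (\<lambda>x. x ^ k * (c * exp (- (1 / l) * x) * indicator {0..} x))
           (c * l ^ Suc k * fact k)"
proof -
  have "1 / l \<noteq> 0" using assms by simp
  from lborel_has_bochner_integral_real_affine_iff[OF this, THEN iffD1, OF exp_power_integral, of 0 k]
  have "has_bochner_integral lborel (\<lambda>x. (0 + (1 / l) * x) ^ k *
      (exp (- (0 + (1 / l) * x)) * indicator {0..} (0 + (1 / l) * x))) (fact k /\<^sub>R \<bar>1 / l\<bar>)" .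
  then have "has_bochner_integral lborel (\<lambda>x. (c * l ^ k) * ((0 + (1 / l) * x) ^ k *
      (exp (- (0 + (1 / l) * x)) * indicator {0..} (0 + (1 / l) * x)))) ((c * l ^ k) * (fact k /\<^sub>R \<bar>1 / l\<bar>))"
    by (intro has_bochner_integral_mult_right) auto
  moreover have "(c * l ^ k) * ((0 + (1 / l) * x) ^ k *
      (exp (- (0 + (1 / l) * x)) * indicator {0..} (0 + (1 / l) * x)))
      = x ^ k * (c * exp (- (1 / l) * x) * indicator {0..} x)" for x
    using assms by (simp add: indicator_def power_divide zero_le_divide_iff)
  moreover have "(c * l ^ k) * (fact k /\<^sub>R \<bar>1 / l\<bar>) = c * l ^ Suc k * fact k"
    using assms by simp
  ultimately show ?thesis by (simp only:)
qed

text \<open>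
  If an affine function always has the sign of \<open>D\<close>, their product is nonnegative with
  integral zero, hence vanishes almost everywhere; the affine function has at most one root.
\<close>

lemma AE_zero_if_affine_multiple_nonneg:
  fixes D :: "real \<Rightarrow> real"
  assumes D: "has_bochner_integral lborel D 0" "has_bochner_integral lborel (\<lambda>x. x * D x) 0"
    and sgn: "\<And>x. x \<noteq> 0 \<Longrightarrow> 0 \<le> (p + q * x) * D x" and ne: "p \<noteq> 0 \<or> q \<noteq> 0"
  shows "AE x in lborel. D x = 0"
proof -
  have "has_bochner_integral lborel (\<lambda>x. p * D x + q * (x * D x)) (p * 0 + q * 0)"
    by (intro has_bochner_integral_add has_bochner_integral_mult_right D)
  then have "has_bochner_integral lborel (\<lambda>x. (p + q * x) * D x) 0"
    by (simp add: algebra_simps)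
  moreover have "AE x in lborel. 0 \<le> (p + q * x) * D x"
    using AE_lborel_singleton[of "0::real"] by eventually_elim (rule sgn)
  ultimately have "AE x in lborel. (p + q * x) * D x = 0"
    using integral_nonneg_eq_0_iff_AE[of lborel "\<lambda>x. (p + q * x) * D x"]
    by (simp add: has_bochner_integral_iff)
  moreover have "AE x in lborel. x \<noteq> - p / q"
    using AE_lborel_singleton[of "- p / q"] by simp
  ultimately show ?thesis
  proof eventually_elim
    case (elim x)
    have "p + q * x \<noteq> 0"
      using elim(2) ne by (cases "q = 0") (auto simp: field_simps add_eq_0_iff)
    then show ?case using elim(1) by simp
  qed
qed

text \<open>
  The extreme is the one-sided exponential with the same value at \<open>0\<close>: with \<open>g\<close> that
  exponential and \<open>t\<close> the threshold where \<open>f - g\<close> changes from plus to minus,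
  \<open>(x - t) (f x - g x) \<le> 0\<close> holds on the right half-line, and also on the left, where
  \<open>g\<close> vanishes. Integrating leaves the difference of the means.
\<close>

lemma pf2_mean_bound:
  fixes f :: "real \<Rightarrow> real"
  assumes pf: "pf2 f" and cont: "continuous_on UNIV f" and nonneg: "\<And>x. 0 \<le> f x"
    and mass: "has_bochner_integral lborel f 1"
    and mean: "has_bochner_integral lborel (\<lambda>x. x * f x) m"
  shows "f 0 * m \<le> 1"
proof (cases "f 0 = 0")
  case False
  define c where "c = f 0"
  have c: "0 < c" "c \<le> f 0" using False nonneg[of 0] by (auto simp: c_def)
  define g where "g x = c * exp (- c * x) * indicator {0..} x" for x :: real
  have g: "has_bochner_integral lborel (\<lambda>x. x ^ k * g x) (c * (1 / c) ^ Suc k * fact k)" for k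
    using scaled_exp_power_integral[of "1 / c" k c] c by (simp add: g_def)
  have g0: "has_bochner_integral lborel g 1" using g[of 0] c by simp
  have g1: "has_bochner_integral lborel (\<lambda>x. x * g x) (1 / c)"
    using g[of 1] c by simp
  define D where "D x = f x - g x" for x
  have D0: "has_bochner_integral lborel D 0"
    unfolding D_def using has_bochner_integral_diff[OF mass g0] by simp
  have D1: "has_bochner_integral lborel (\<lambda>x. x * D x) (m - 1 / c)"
    unfolding D_def using has_bochner_integral_diff[OF mean g1] by (simp add: algebra_simps)
  have neg: "0 \<le> D x" if "x < 0" for x using that nonneg[of x] by (simp add: D_def g_def)
  have "m \<le> 1 / c"
  proof (cases rule: pf2_crossing_threshold[OF pf cont nonneg c, of c])
    case 1
    then have "0 \<le> D x" for x using neg[of x] by (cases "x < 0") (auto simp: D_def g_def)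
    moreover have "integral\<^sup>L lborel D = 0" "integrable lborel D"
      using D0 by (auto simp: has_bochner_integral_iff)
    ultimately have "AE x in lborel. D x = 0"
      using integral_nonneg_eq_0_iff_AE[of lborel D] by simp
    then have "AE x in lborel. x * D x = 0" by eventually_elim simp
    then have "integral\<^sup>L lborel (\<lambda>x. x * D x) = 0"
      by (rule integral_eq_zero_AE)
    then show ?thesis using D1 by (simp add: has_bochner_integral_iff)
  next
    case (2 t)
    have "(x - t) * D x \<le> 0" for x
    proof (cases "x < 0")
      case True
      then show ?thesis using neg[of x] 2(1) by (intro mult_nonpos_nonneg) auto
    next
      case False
      then show ?thesis using 2(2)[of x] 2(3)[of x]
        by (cases x t rule: linorder_cases) (auto simp: D_def g_def intro: mult_nonpos_nonneg mult_nonneg_nonpos)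
    qed
    moreover have "has_bochner_integral lborel (\<lambda>x. (x - t) * D x) ((m - 1 / c) - t * 0)"
      using has_bochner_integral_diff[OF D1 has_bochner_integral_mult_right[OF D0, of t]]
      by (simp add: algebra_simps)
    ultimately have "m - 1 / c \<le> 0"
      using integral_mono[of lborel "\<lambda>x. (x - t) * D x" "\<lambda>x. 0"] by (simp add: has_bochner_integral_iff)
    then show ?thesis by simp
  qed
  then show ?thesis using c by (simp add: c_def field_simps)
qed auto

text \<open>
  Comparison with a two-sided exponential \<open>g\<close> having \<open>g 0 = c\<close> and the mass and mean of \<open>f\<close>;
  the scales \<open>\<alpha>\<close> and \<open>\<beta>\<close> of its two branches then satisfy
  \<open>\<alpha> + \<beta> = 1 / c\<close> and \<open>\<alpha> - \<beta> = m\<close>. The difference \<open>f - g\<close> has sign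
  pattern minus, plus, minus, so a quadratic with roots at the two sign changes shows that
  the second moment of \<open>f\<close> is at most that of \<open>g\<close>, namely
  \<open>2 c (\<alpha>\<^sup>3 + \<beta>\<^sup>3)\<close>. Expressed through \<open>c\<close> and \<open>m\<close> this is the
  claim. The condition \<open>c * m < 1\<close> makes both scales positive.
\<close>

lemma pf2_second_moment_comparison:
  fixes f :: "real \<Rightarrow> real"
  assumes pf: "pf2 f" and cont: "continuous_on UNIV f" and nonneg: "\<And>x. 0 \<le> f x"
    and mass: "has_bochner_integral lborel f 1"
    and mean: "has_bochner_integral lborel (\<lambda>x. x * f x) m"
    and second: "has_bochner_integral lborel (\<lambda>x. x\<^sup>2 * f x) s"
    and c: "0 < c" "c \<le> f 0" and m: "0 \<le> m" "c * m < 1"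
  shows "c\<^sup>2 * (2 * s - 3 * m\<^sup>2) \<le> 1"
proof -
  \<comment> \<open>The scales of the two branches, determined by mass \<open>1\<close> and mean \<open>m\<close>.\<close>
  define \<alpha> \<beta> where "\<alpha> = (1 / c + m) / 2" and "\<beta> = (1 / c - m) / 2"
  have m1: "m < 1 / c" using m c by (simp add: field_simps)
  have pos: "0 < \<alpha>" "0 < \<beta>" using m1 m by (auto simp: \<alpha>_def \<beta>_def)
  define gp where "gp x = c * exp (- (1 / \<alpha>) * x) * indicator {0..} x" for x :: real
  define gm where "gm x = c * exp (- (1 / \<beta>) * x) * indicator {0..} x" for x :: real
  have gp: "has_bochner_integral lborel (\<lambda>x. x ^ k * gp x) (c * \<alpha> ^ Suc k * fact k)" for k
    unfolding gp_def by (rule scaled_exp_power_integral) fact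
  have gm: "has_bochner_integral lborel (\<lambda>x. (- x) ^ k * gm (- x)) (c * \<beta> ^ Suc k * fact k)" for k
    using lborel_has_bochner_integral_real_affine_iff[of "-1" "\<lambda>x. x ^ k * gm x" _ 0]
      scaled_exp_power_integral[OF pos(2), of k c] by (simp add: gm_def)
  define D where "D x = f x - (gp x + gm (- x))" for x
  have eq: "\<alpha> + \<beta> = 1 / c" "\<alpha> - \<beta> = m" by (auto simp: \<alpha>_def \<beta>_def field_simps)
  have D0: "has_bochner_integral lborel D 0"
  proof -
    have "has_bochner_integral lborel D (1 - (c * \<alpha> + c * \<beta>))"
      unfolding D_def using gp[of 0] gm[of 0]
      by (intro has_bochner_integral_diff has_bochner_integral_add mass) auto
    moreover have "c * \<alpha> + c * \<beta> = 1" using eq(1) c by (simp add: field_simps)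
    ultimately show ?thesis by simp
  qed
  have D1: "has_bochner_integral lborel (\<lambda>x. x * D x) 0"
  proof -
    have "has_bochner_integral lborel (\<lambda>x. - ((- x) ^ 1 * gm (- x))) (- (c * \<beta> ^ Suc 1 * fact 1))"
      by (intro has_bochner_integral_minus gm)
    then have "has_bochner_integral lborel (\<lambda>x. x * f x - (x ^ 1 * gp x + x * gm (- x)))
        (m - (c * \<alpha> ^ Suc 1 * fact 1 + - (c * \<beta> ^ Suc 1 * fact 1)))"
      by (intro has_bochner_integral_diff has_bochner_integral_add mean gp) simp
    moreover have "c * \<alpha> ^ Suc 1 * fact 1 + - (c * \<beta> ^ Suc 1 * fact 1) = c * (\<alpha> + \<beta>) * (\<alpha> - \<beta>)"
      by (simp add: algebra_simps power2_eq_square)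
    moreover have "\<dots> = m" using eq c by simp
    ultimately show ?thesis by (simp add: D_def algebra_simps)
  qed
  have D2: "has_bochner_integral lborel (\<lambda>x. x\<^sup>2 * D x) (s - 2 * c * (\<alpha> ^ 3 + \<beta> ^ 3))"
  proof -
    have "has_bochner_integral lborel (\<lambda>x. x\<^sup>2 * f x - (x ^ 2 * gp x + (- x)^2 * gm (- x)))
        (s - (c * \<alpha> ^ Suc 2 * fact 2 + c * \<beta> ^ Suc 2 * fact 2))"
      by (intro has_bochner_integral_diff has_bochner_integral_add second gp gm)
    then show ?thesis by (simp add: D_def algebra_simps numeral_3_eq_3)
  qed
  have Dp: "D x = f x - c * exp (- (1 / \<alpha>) * x)" if "0 < x" for x
    using that by (simp add: D_def gp_def gm_def)
  have Dm: "D x = f x - c * exp (- (1 / \<beta>) * (- x))" if "x < 0" for x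
    using that by (simp add: D_def gp_def gm_def)
  \<comment> \<open>At the origin itself both branches of the comparison density are counted, so
    signs are only claimed away from it; a single point does not affect the integrals.\<close>
  have key: "s - 2 * c * (\<alpha> ^ 3 + \<beta> ^ 3) \<le> 0"
  proof -
    have vanish: ?thesis if ae: "AE x in lborel. D x = 0"
    proof -
      from ae have "AE x in lborel. x\<^sup>2 * D x = 0" by eventually_elim simp
      then have "integral\<^sup>L lborel (\<lambda>x. x\<^sup>2 * D x) = 0" by (rule integral_eq_zero_AE)
      then show ?thesis using D2 by (simp add: has_bochner_integral_iff)
    qed
    \<comment> \<open>On each half-line the difference changes sign at most once, from plus to
      minus; the threshold may be infinite (\<open>Dpos\<close>, \<open>Dneg\<close>).\<close>
    define Dpos where "Dpos \<longleftrightarrow> (\<forall>x>0. 0 \<le> D x)"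
    define Dneg where "Dneg \<longleftrightarrow> (\<forall>x<0. 0 \<le> D x)"
    define tpos where "tpos t \<longleftrightarrow> 0 \<le> t \<and> (\<forall>x>0. (x < t \<longrightarrow> 0 \<le> D x) \<and> (t < x \<longrightarrow> D x \<le> 0))" for t
    define tneg where "tneg t \<longleftrightarrow> 0 \<le> t \<and> (\<forall>x<0. (- t < x \<longrightarrow> 0 \<le> D x) \<and> (x < - t \<longrightarrow> D x \<le> 0))" for t
    have right: "Dpos \<or> (\<exists>t. tpos t)"
      by (cases rule: pf2_crossing_threshold[OF pf cont nonneg c, of "1 / \<alpha>"])
        (auto simp: Dpos_def tpos_def Dp)
    have left: "Dneg \<or> (\<exists>t. tneg t)"
    proof -
      have cont': "continuous_on UNIV (\<lambda>x. f (- x))"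
        by (intro continuous_on_compose2[OF cont] continuous_intros) auto
      show ?thesis
      proof (cases rule: pf2_crossing_threshold[OF pf2_reflect[OF pf] cont', of c "1 / \<beta>"])
        case 4
        have "0 \<le> D x" if "x < 0" for x using 4[of "- x"] Dm[OF that] that by simp
        then show ?thesis by (simp add: Dneg_def)
      next
        case (5 t)
        have "- t < x \<Longrightarrow> 0 \<le> D x" "x < - t \<Longrightarrow> D x \<le> 0" if "x < 0" for x
          using 5(2,3)[of "- x"] Dm[OF that] that by auto
        then have "tneg t" using 5(1) by (simp add: tneg_def)
        then show ?thesis by blast
      qed (use nonneg c in auto)
    qed
    \<comment> \<open>With an infinite threshold the sign pattern is so poor that an affine
      function already matches it, and equality of masses and means forces the two densities to
      agree almost everywhere.\<close>
    have affine: ?thesis if "\<And>x. x \<noteq> 0 \<Longrightarrow> 0 \<le> (p + q * x) * D x" "p \<noteq> 0 \<or> q \<noteq> 0" for p q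
      using vanish AE_zero_if_affine_multiple_nonneg[OF D0 D1 that] by blast
    consider "Dpos" "Dneg" | t where "Dpos" "tneg t" | t where "tpos t" "Dneg"
      | t u where "tpos t" "tneg u" using left right by blast
    then show ?thesis
    proof cases
      case 1
      then show ?thesis by (intro affine[of 1 0]) (force simp: Dpos_def Dneg_def linorder_neq_iff)+
    next
      case 2
      have "0 \<le> (t + 1 * x) * D x" if "x \<noteq> 0" for x
      proof (cases "x < - t")
        case True
        then have "x < 0" "D x \<le> 0" using 2(2) by (auto simp: tneg_def)
        then show ?thesis using True by (intro mult_nonpos_nonpos) auto
      next
        case False
        then have "x = - t \<or> 0 \<le> D x"
          using 2 that by (cases "x < 0") (auto simp: Dpos_def tneg_def)
        then show ?thesis using False by auto
      qed
      then show ?thesis by (rule affine) auto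
    next
      case 3
      have "0 \<le> (t + (- 1) * x) * D x" if "x \<noteq> 0" for x
      proof (cases "t < x")
        case True
        then have "0 < x" "D x \<le> 0" using 3(1) by (auto simp: tpos_def)
        then show ?thesis using True by (intro mult_nonpos_nonpos) auto
      next
        case False
        then have "x = t \<or> 0 \<le> D x"
          using 3 that by (cases "x < 0"; cases "x < t") (auto simp: Dneg_def tpos_def)
        then show ?thesis using False by auto
      qed
      then show ?thesis by (rule affine) auto
    next
      case 4
      have "(x - t) * (x + u) * D x \<le> 0" if "x \<noteq> 0" for x
      proof (cases "x < 0")
        case True
        then have "x - t \<le> 0" "0 \<le> (x + u) * D x"
          using 4 unfolding tpos_def tneg_def
          by (auto, cases x "- u" rule: linorder_cases) (auto intro: mult_nonpos_nonpos)
        then show ?thesis by (simp add: mult.assoc mult_nonpos_nonneg)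
      next
        case False
        then have "0 \<le> x + u" "(x - t) * D x \<le> 0"
          using 4 that unfolding tpos_def tneg_def
          by (auto, cases x t rule: linorder_cases) (auto intro: mult_nonpos_nonneg mult_nonneg_nonpos)
        then have "(x + u) * ((x - t) * D x) \<le> 0" by (rule mult_nonneg_nonpos)
        then show ?thesis by (simp only: mult_ac)
      qed
      then have ae: "AE x in lborel. (x - t) * (x + u) * D x \<le> 0"
        using AE_lborel_singleton[of "0::real"] by (auto elim: eventually_mono)
      have "has_bochner_integral lborel (\<lambda>x. x\<^sup>2 * D x + ((u - t) * (x * D x) - (t * u) * D x))
          (s - 2 * c * (\<alpha> ^ 3 + \<beta> ^ 3) + ((u - t) * 0 - (t * u) * 0))"
        by (intro has_bochner_integral_add has_bochner_integral_diff has_bochner_integral_mult_right D0 D1 D2)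
      then have "has_bochner_integral lborel (\<lambda>x. (x - t) * (x + u) * D x) (s - 2 * c * (\<alpha> ^ 3 + \<beta> ^ 3))"
        by (simp add: algebra_simps power2_eq_square)
      then show ?thesis
        using integral_mono_AE[of lborel "\<lambda>x. (x - t) * (x + u) * D x" "\<lambda>x. 0"] ae
        by (simp add: has_bochner_integral_iff)
    qed
  qed
  have "2 * c * (\<alpha> ^ 3 + \<beta> ^ 3) = 2 * (c * (\<alpha> + \<beta>)) * (\<alpha>\<^sup>2 - \<alpha> * \<beta> + \<beta>\<^sup>2)"
    by (simp add: algebra_simps power2_eq_square power3_eq_cube)
  also have "c * (\<alpha> + \<beta>) = 1" using eq(1) c by simp
  finally have "2 * s \<le> 4 * (\<alpha>\<^sup>2 - \<alpha> * \<beta> + \<beta>\<^sup>2)" using key by simp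
  also have "\<dots> = (\<alpha> + \<beta>)\<^sup>2 + 3 * (\<alpha> - \<beta>)\<^sup>2" by (simp add: algebra_simps power2_eq_square)
  finally have "2 * s - 3 * m\<^sup>2 \<le> (1 / c)\<^sup>2" unfolding eq by simp
  then show ?thesis using c by (simp add: field_simps power2_eq_square)
qed

text \<open>
  The one-dimensional inequality behind the theorem. In terms of the variance
  \<open>\<sigma>\<^sup>2\<close> it says that a continuous log-concave density is at most
  \<open>1 / sqrt (2 \<sigma>\<^sup>2 - m\<^sup>2)\<close> at a point at distance \<open>m\<close> to the left of its
  mean.
\<close>

theorem pf2_density_bound:
  fixes f :: "real \<Rightarrow> real"
  assumes pf: "pf2 f" and cont: "continuous_on UNIV f" and nonneg: "\<And>x. 0 \<le> f x"
    and mass: "has_bochner_integral lborel f 1"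
    and mean: "has_bochner_integral lborel (\<lambda>x. x * f x) m"
    and second: "has_bochner_integral lborel (\<lambda>x. x\<^sup>2 * f x) s"
    and m: "0 \<le> m" and pos: "0 < 2 * s - 3 * m\<^sup>2"
  shows "f 0 \<le> 1 / sqrt (2 * s - 3 * m\<^sup>2)"
proof (cases "f 0 = 0")
  case False
  then have f0: "0 < f 0" using nonneg[of 0] by simp
  let ?T = "2 * s - 3 * m\<^sup>2"
  \<comment> \<open>The mean bound is not strict. Lowering the value at the origin by a factor
    \<open>z < 1\<close> makes it strict, so that both branches of the comparison density are proper
    exponentials.\<close>
  have "z * (f 0 * sqrt ?T) \<le> 1" if z: "0 < z" "z < 1" for z
  proof -
    have "z * f 0 * m < 1"
    proof (cases "m = 0")
      case False
      then have "z * (f 0 * m) < 1 * (f 0 * m)"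
        using z f0 m by (intro mult_strict_right_mono) auto
      then show ?thesis using pf2_mean_bound[OF pf cont nonneg mass mean] by (simp add: mult.assoc)
    qed simp
    then have "(z * f 0)\<^sup>2 * ?T \<le> 1"
      using z f0 m by (intro pf2_second_moment_comparison[OF pf cont nonneg mass mean second]) auto
    moreover have "(z * (f 0 * sqrt ?T))\<^sup>2 = (z * f 0)\<^sup>2 * ?T"
      using pos by (simp add: power_mult_distrib)
    ultimately show ?thesis
      using abs_square_le_1[of "z * (f 0 * sqrt ?T)"] by simp
  qed
  then have "f 0 * sqrt ?T \<le> 1" by (rule field_le_mult_one_interval)
  then show ?thesis using pos by (simp add: pos_le_divide_eq)
qed (use pos in auto)

section \<open>Convolutions of log-concave functions\<close>

lemma ennreal_rearrangement:
  fixes p q p' q' :: ennreal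
  assumes "p' \<le> p" "q' \<le> q"
  shows "p * q' + p' * q \<le> p * q + p' * q'"
proof -
  obtain d e where "p = p' + d" "q = q' + e"
    using assms by (auto simp: le_iff_add)
  then show ?thesis by (simp add: algebra_simps)
qed

text \<open>
  The basic composition formula for two-by-two determinants (Cauchy--Binet), written without
  subtraction so that it applies to extended nonnegative integrals.
\<close>

lemma pf2_convolution:
  fixes f k :: "real \<Rightarrow> ennreal"
  assumes f: "pf2 f" and k: "pf2 k"
    and [measurable]: "f \<in> borel_measurable borel" "k \<in> borel_measurable borel"
  shows "pf2 (\<lambda>x. \<integral>\<^sup>+ w. f (x - w) * k w \<partial>lborel)"
  unfolding pf2_def
proof (intro allI impI)
  fix x1 x2 z1 z2 :: real assume x: "x1 \<le> x2" and z: "z1 \<le> z2"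
  define F where "F x z = (\<integral>\<^sup>+ w. f (x - w) * k (w - z) \<partial>lborel)" for x z
  have F: "(\<integral>\<^sup>+ w. f (x - z - w) * k w \<partial>lborel) = F x z" for x z
    using nn_integral_real_affine[of "\<lambda>w. f (x - z - w) * k w" 1 "- z"]
    by (simp add: F_def algebra_simps)
  define p where "p v w = f (x1 - v) * f (x2 - w)" for v w
  define q where "q v w = k (v - z1) * k (w - z2)" for v w
  have prod1: "F x1 z2 * F x2 z1 = (\<integral>\<^sup>+ v. \<integral>\<^sup>+ w. p v w * q w v \<partial>lborel \<partial>lborel)"
    unfolding F_def p_def q_def
    by (subst nn_integral_multc[symmetric], measurable, subst nn_integral_cmult[symmetric], measurable)
       (simp add: mult_ac)
  have prod2: "F x1 z1 * F x2 z2 = (\<integral>\<^sup>+ v. \<integral>\<^sup>+ w. p v w * q v w \<partial>lborel \<partial>lborel)"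
    unfolding F_def p_def q_def
    by (subst nn_integral_multc[symmetric], measurable, subst nn_integral_cmult[symmetric], measurable)
       (simp add: mult_ac)
  have [measurable]: "case_prod p \<in> borel_measurable (borel \<Otimes>\<^sub>M borel)"
      "case_prod q \<in> borel_measurable (borel \<Otimes>\<^sub>M borel)"
    unfolding p_def q_def by measurable
  \<comment> \<open>Symmetrising in the two integration variables turns both products into
    integrals to which the rearrangement inequality applies pointwise.\<close>
  have swap1: "(\<integral>\<^sup>+ v. \<integral>\<^sup>+ w. p v w * q w v \<partial>lborel \<partial>lborel)
      = (\<integral>\<^sup>+ v. \<integral>\<^sup>+ w. p w v * q v w \<partial>lborel \<partial>lborel)"
    by (rule lborel_pair.Fubini') measurable
  have swap2: "(\<integral>\<^sup>+ v. \<integral>\<^sup>+ w. p v w * q v w \<partial>lborel \<partial>lborel)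
      = (\<integral>\<^sup>+ v. \<integral>\<^sup>+ w. p w v * q w v \<partial>lborel \<partial>lborel)"
    by (rule lborel_pair.Fubini') measurable
  have pointwise: "p v w * q w v + p w v * q v w \<le> p v w * q v w + p w v * q w v" for v w
  proof -
    have le: "p w v * q v w + p v w * q w v \<le> p v w * q v w + p w v * q w v" if "v \<le> w" for v w
    proof -
      have "p w v \<le> p v w"
        using f[unfolded pf2_def, rule_format, OF x that] by (simp add: p_def)
      moreover have "q w v \<le> q v w"
        using k[unfolded pf2_def, rule_format, OF that z] by (simp add: q_def mult.commute)
      ultimately show ?thesis
        using ennreal_rearrangement[of "p w v" "p v w" "q w v" "q v w"] by (simp add: add.commute)
    qed
    show ?thesis using le[of v w] le[of w v] by (cases "v \<le> w") (auto simp: add.commute)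
  qed
  have "2 * (F x1 z2 * F x2 z1) = (\<integral>\<^sup>+ v. \<integral>\<^sup>+ w. p v w * q w v + p w v * q v w \<partial>lborel \<partial>lborel)"
    by (simp add: nn_integral_add mult_2 prod1 flip: swap1)
  also have "\<dots> \<le> (\<integral>\<^sup>+ v. \<integral>\<^sup>+ w. p v w * q v w + p w v * q w v \<partial>lborel \<partial>lborel)"
    by (intro nn_integral_mono pointwise)
  also have "\<dots> = 2 * (F x1 z1 * F x2 z2)"
    by (simp add: nn_integral_add mult_2 prod2 flip: swap2)
  finally have "F x1 z2 * F x2 z1 \<le> F x1 z1 * F x2 z2"
    by (subst (asm) ennreal_mult_le_mult_iff) auto
  then show "(\<integral>\<^sup>+ w. f (x1 - z2 - w) * k w \<partial>lborel) * (\<integral>\<^sup>+ w. f (x2 - z1 - w) * k w \<partial>lborel)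
      \<le> (\<integral>\<^sup>+ w. f (x1 - z1 - w) * k w \<partial>lborel) * (\<integral>\<^sup>+ w. f (x2 - z2 - w) * k w \<partial>lborel)"
    by (simp only: F)
qed

section \<open>Linear combinations of independent exponential variables\<close>

definition exp_dens :: "real \<Rightarrow> ennreal" where
  "exp_dens x = ennreal (exp (- x) * indicator {0..} x)"

text \<open>
  The density of \<open>a * E\<close> for a standard exponential variable \<open>E\<close> and \<open>a \<noteq> 0\<close> of
  either sign.
\<close>

definition scaled_exp_dens :: "real \<Rightarrow> real \<Rightarrow> ennreal" where
  "scaled_exp_dens a u = ennreal (1 / \<bar>a\<bar>) * exp_dens (u / a)"

lemma exp_dens_measurable [measurable]: "exp_dens \<in> borel_measurable borel"
  unfolding exp_dens_def by measurable

lemma scaled_exp_dens_measurable [measurable]: "scaled_exp_dens a \<in> borel_measurable borel"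
  unfolding scaled_exp_dens_def by measurable

lemma pf2_scaled_exp_dens: "pf2 (scaled_exp_dens a)"
  unfolding pf2_def
proof (intro allI impI)
  fix x1 x2 z1 z2 :: real assume x: "x1 \<le> x2" and z: "z1 \<le> z2"
  have *: "exp_dens s * exp_dens t = ennreal (exp (- (s + t)) * (indicator {0..} s * indicator {0..} t))" for s t
    by (simp add: exp_dens_def ennreal_mult'[symmetric] mult_exp_exp indicator_def)
  have ind: "indicator {0..} ((x1 - z2) / a) * indicator {0..} ((x2 - z1) / a)
      \<le> (indicator {0..} ((x1 - z1) / a) * indicator {0..} ((x2 - z2) / a) :: real)"
    using x z by (auto simp: indicator_def zero_le_divide_iff)
  have "exp_dens ((x1 - z2) / a) * exp_dens ((x2 - z1) / a)
      \<le> exp_dens ((x1 - z1) / a) * exp_dens ((x2 - z2) / a)"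
    unfolding * using mult_left_mono[OF ind, of "exp (- (x1 + x2 - z1 - z2) / a)"]
    by (intro ennreal_leI) (simp add: add_divide_distrib[symmetric] diff_divide_distrib[symmetric] algebra_simps)
  then have "ennreal (1 / \<bar>a\<bar>) * ennreal (1 / \<bar>a\<bar>) *
        (exp_dens ((x1 - z2) / a) * exp_dens ((x2 - z1) / a))
      \<le> ennreal (1 / \<bar>a\<bar>) * ennreal (1 / \<bar>a\<bar>) *
        (exp_dens ((x1 - z1) / a) * exp_dens ((x2 - z2) / a))"
    by (rule mult_left_mono) simp
  then show "scaled_exp_dens a (x1 - z2) * scaled_exp_dens a (x2 - z1)
      \<le> scaled_exp_dens a (x1 - z1) * scaled_exp_dens a (x2 - z2)"
    unfolding scaled_exp_dens_def by (simp only: mult_ac)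
qed

definition exp_measure :: "real measure" where
  "exp_measure = density lborel exp_dens"

lemma sets_exp_measure [simp, measurable_cong]: "sets exp_measure = sets borel"
  and space_exp_measure [simp]: "space exp_measure = UNIV"
  by (simp_all add: exp_measure_def)

lemma exp_measure_power: "has_bochner_integral exp_measure (\<lambda>x. x ^ k) (fact k)"
proof (rule has_bochner_integral_nn_integral)
  have "AE x in exp_measure. 0 \<le> x"
    unfolding exp_measure_def by (subst AE_density) (auto simp: exp_dens_def indicator_def)
  then show "AE x in exp_measure. 0 \<le> x ^ k" by eventually_elim simp
  have "(\<integral>\<^sup>+ x. ennreal (x ^ k) \<partial>exp_measure) = (\<integral>\<^sup>+x. ennreal (x^k * exp (-x)) * indicator {0 ..} x \<partial>lborel)"
    unfolding exp_measure_def by (subst nn_integral_density)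
      (auto intro!: nn_integral_cong simp: exp_dens_def indicator_def ennreal_mult'[symmetric] mult.commute)
  also have "\<dots> = ennreal (fact k)"
    by (subst nn_intergal_power_times_exp_Ici) simp
  finally show "(\<integral>\<^sup>+ x. ennreal (x ^ k) \<partial>exp_measure) = ennreal (fact k)" .
qed (simp_all add: exp_measure_def)

lemma prob_space_exp_measure: "prob_space exp_measure"
proof
  have "(\<integral>\<^sup>+ x. 1 \<partial>exp_measure) = 1"
    using exp_measure_power[of 0] has_bochner_integral_iff
    by (metis (mono_tags, lifting) ennreal_1 fact_0 has_bochner_integral_iff nn_integral_cong nn_integral_eq_integral power_0 zero_le_one always_eventually)
  then show "emeasure exp_measure (space exp_measure) = 1" by simp
qed

interpretation exp_prod: product_sigma_finite "\<lambda>_. exp_measure"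
proof -
  interpret prob_space exp_measure by (rule prob_space_exp_measure)
  show "product_sigma_finite (\<lambda>_. exp_measure)"
    by standard
qed

lemma nn_integral_scaled_exp_dens:
  assumes a: "a \<noteq> 0" and [measurable]: "g \<in> borel_measurable borel"
  shows "(\<integral>\<^sup>+ u. g u * scaled_exp_dens a (u - s) \<partial>lborel) = (\<integral>\<^sup>+ y. g (s + a * y) \<partial>exp_measure)"
proof -
  have cancel: "ennreal \<bar>a\<bar> * ennreal (1 / \<bar>a\<bar>) = 1"
    using a by (simp add: ennreal_mult'[symmetric])
  have "(\<integral>\<^sup>+ u. g u * scaled_exp_dens a (u - s) \<partial>lborel)
      = ennreal \<bar>a\<bar> * (\<integral>\<^sup>+ y. g (s + a * y) * scaled_exp_dens a (s + a * y - s) \<partial>lborel)"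
    by (rule nn_integral_real_affine[OF _ a]) measurable
  also have "\<dots> = (\<integral>\<^sup>+ y. (ennreal \<bar>a\<bar> * ennreal (1 / \<bar>a\<bar>)) * (exp_dens y * g (s + a * y)) \<partial>lborel)"
  proof -
    have "ennreal \<bar>a\<bar> * (g (s + a * y) * scaled_exp_dens a (s + a * y - s))
        = (ennreal \<bar>a\<bar> * ennreal (1 / \<bar>a\<bar>)) * (exp_dens y * g (s + a * y))" for y
    proof -
      have "(s + a * y - s) / a = y" using a by simp
      then show ?thesis unfolding scaled_exp_dens_def by (simp only: mult_ac)
    qed
    then show ?thesis by (subst nn_integral_cmult[symmetric]) simp_all
  qed
  also have "\<dots> = (\<integral>\<^sup>+ y. g (s + a * y) \<partial>exp_measure)"
    unfolding cancel exp_measure_def by (simp add: nn_integral_density)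
  finally show ?thesis .
qed

text \<open>
  The density at \<open>u\<close> of \<open>a i * E i + (\<Sum>j\<in>A. a j * E j)\<close> for independent standard
  exponential variables, obtained by conditioning on all variables but \<open>E i\<close> (for
  \<open>a i \<noteq> 0\<close> and \<open>i \<notin> A\<close>). A definition by an integral, rather than as a
  Radon--Nikodym derivative, fixes the value at every point; the value at \<open>0\<close> is what
  matters.
\<close>

definition comb_dens :: "'i \<Rightarrow> 'i set \<Rightarrow> ('i \<Rightarrow> real) \<Rightarrow> real \<Rightarrow> ennreal" where
  "comb_dens i A a u =
     (\<integral>\<^sup>+ y. scaled_exp_dens (a i) (u - (\<Sum>j\<in>A. a j * y j)) \<partial>(\<Pi>\<^sub>M j\<in>A. exp_measure))"

lemma sigma_finite_exp_prod: "finite A \<Longrightarrow> sigma_finite_measure (\<Pi>\<^sub>M j\<in>A. exp_measure)"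
  by (rule exp_prod.sigma_finite)

lemma prob_space_exp_prod: "prob_space (\<Pi>\<^sub>M j\<in>A. exp_measure)"
  by (intro prob_space_PiM prob_space_exp_measure)

lemma comb_dens_measurable [measurable]:
  assumes "finite A"
  shows "comb_dens i A a \<in> borel_measurable borel"
proof -
  interpret sigma_finite_measure "\<Pi>\<^sub>M j\<in>A. exp_measure"
    using assms by (rule sigma_finite_exp_prod)
  show ?thesis unfolding comb_dens_def by measurable
qed

lemma comb_dens_le:
  assumes "finite A"
  shows "comb_dens i A a u \<le> ennreal (1 / \<bar>a i\<bar>)"
proof -
  interpret prob_space "\<Pi>\<^sub>M j\<in>A. exp_measure" by (rule prob_space_exp_prod)
  have "scaled_exp_dens (a i) x \<le> ennreal (1 / \<bar>a i\<bar>)" for x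
    by (auto simp: scaled_exp_dens_def exp_dens_def indicator_def ennreal_mult'[symmetric] intro!: ennreal_leI
        divide_right_mono)
  then have "comb_dens i A a u \<le> (\<integral>\<^sup>+ y. ennreal (1 / \<bar>a i\<bar>) \<partial>(\<Pi>\<^sub>M j\<in>A. exp_measure))"
    unfolding comb_dens_def by (intro nn_integral_mono)
  then show ?thesis by (simp add: emeasure_space_1)
qed

lemma comb_dens_insert:
  assumes A: "finite A" "j \<notin> A"
  shows "comb_dens i (insert j A) a u = (\<integral>\<^sup>+ t. comb_dens i A a (u - a j * t) \<partial>exp_measure)"
proof -
  have "(\<Sum>l\<in>A. a l * (if l = j then t else y l)) = (\<Sum>l\<in>A. a l * y l)" for y t
    using A by (intro sum.cong) auto
  then show ?thesis
    unfolding comb_dens_def using A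
    by (subst exp_prod.product_nn_integral_insert_rev) (simp_all add: diff_diff_eq)
qed

lemma comb_dens_insert_zero:
  assumes "finite A" "j \<notin> A" "a j = 0"
  shows "comb_dens i (insert j A) a = comb_dens i A a"
  using assms prob_space.emeasure_space_1[OF prob_space_exp_measure]
  by (simp add: comb_dens_insert fun_eq_iff)

lemma comb_dens_insert_convolution:
  assumes A: "finite A" "j \<notin> A" and "a j \<noteq> 0"
  shows "comb_dens i (insert j A) a u = (\<integral>\<^sup>+ w. comb_dens i A a (u - w) * scaled_exp_dens (a j) w \<partial>lborel)"
  using nn_integral_scaled_exp_dens[of "a j" "\<lambda>w. comb_dens i A a (u - w)" 0] assms
  by (simp add: comb_dens_insert)

text \<open>
  The density arises from an exponential density by convolving with further ones.
\<close>

lemma pf2_comb_dens: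
  assumes "finite A"
  shows "pf2 (comb_dens i A a)"
  using assms
proof (induction A rule: finite_induct)
  case empty
  have "comb_dens i {} a = scaled_exp_dens (a i)"
    by (simp add: comb_dens_def fun_eq_iff PiM_empty)
  then show ?case by (simp add: pf2_scaled_exp_dens)
next
  case (insert j A)
  show ?case
  proof (cases "a j = 0")
    case False
    have "comb_dens i (insert j A) a = (\<lambda>u. \<integral>\<^sup>+ w. comb_dens i A a (u - w) * scaled_exp_dens (a j) w \<partial>lborel)"
      using insert.hyps False by (simp add: comb_dens_insert_convolution fun_eq_iff)
    moreover have "pf2 \<dots>"
      using insert by (intro pf2_convolution pf2_scaled_exp_dens comb_dens_measurable) auto
    ultimately show ?thesis by simp
  qed (use insert in \<open>simp add: comb_dens_insert_zero\<close>)
qed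

text \<open>
  Tonelli and the substitution \<open>u = s + a i * y\<close>; with indicators for \<open>g\<close> this says that
  \<open>comb_dens\<close> is a density of the linear combination.
\<close>

lemma nn_integral_comb_dens:
  assumes A: "finite A" "i \<notin> A" and ai: "a i \<noteq> 0" and [measurable]: "g \<in> borel_measurable borel"
  shows "(\<integral>\<^sup>+ u. g u * comb_dens i A a u \<partial>lborel)
      = (\<integral>\<^sup>+ y. g (\<Sum>j\<in>insert i A. a j * y j) \<partial>(\<Pi>\<^sub>M j\<in>insert i A. exp_measure))"
proof -
  interpret P: sigma_finite_measure "\<Pi>\<^sub>M j\<in>A. exp_measure"
    using A by (intro sigma_finite_exp_prod)
  interpret pair_sigma_finite lborel "\<Pi>\<^sub>M j\<in>A. exp_measure" ..
  have "(\<integral>\<^sup>+ u. g u * comb_dens i A a u \<partial>lborel)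
    = (\<integral>\<^sup>+ u. \<integral>\<^sup>+ y. g u * scaled_exp_dens (a i) (u - (\<Sum>j\<in>A. a j * y j)) \<partial>(\<Pi>\<^sub>M j\<in>A. exp_measure) \<partial>lborel)"
    unfolding comb_dens_def by (intro nn_integral_cong) (simp add: nn_integral_cmult)
  also have "\<dots> = (\<integral>\<^sup>+ y. \<integral>\<^sup>+ u. g u * scaled_exp_dens (a i) (u - (\<Sum>j\<in>A. a j * y j)) \<partial>lborel \<partial>(\<Pi>\<^sub>M j\<in>A. exp_measure))"
    by (rule Fubini'[symmetric]) measurable
  also have "\<dots> = (\<integral>\<^sup>+ y. \<integral>\<^sup>+ t. g ((\<Sum>j\<in>A. a j * y j) + a i * t) \<partial>exp_measure \<partial>(\<Pi>\<^sub>M j\<in>A. exp_measure))"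
    using ai by (simp add: nn_integral_scaled_exp_dens)
  also have "\<dots> = (\<integral>\<^sup>+ y. g (\<Sum>j\<in>insert i A. a j * y j) \<partial>(\<Pi>\<^sub>M j\<in>insert i A. exp_measure))"
  proof -
    have "(\<Sum>l\<in>A. a l * (if l = i then t else y l)) = (\<Sum>l\<in>A. a l * y l)" for y t
      using A by (intro sum.cong) auto
    then show ?thesis using A
      by (subst exp_prod.product_nn_integral_insert) (simp_all add: add.commute)
  qed
  finally show ?thesis .
qed

lemma comb_dens_eq_ennreal: "finite A \<Longrightarrow> comb_dens i A a u = ennreal (enn2real (comb_dens i A a u))"
  using comb_dens_le[of A i a u] by (metis ennreal_enn2real ennreal_less_top le_less_trans)

text \<open>
  Moments of the density are computed on the product space, where independence makes them
  easy.
\<close>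

lemma comb_dens_moment:
  assumes A: "finite A" "i \<notin> A" and ai: "a i \<noteq> 0" and [measurable]: "g \<in> borel_measurable borel"
    and "has_bochner_integral (\<Pi>\<^sub>M j\<in>insert i A. exp_measure) (\<lambda>y. g (\<Sum>j\<in>insert i A. a j * y j)) (M :: real)"
  shows "has_bochner_integral lborel (\<lambda>x. g x * enn2real (comb_dens i A a x)) M"
proof -
  let ?S = "\<lambda>y. \<Sum>j\<in>insert i A. a j * y j" and ?P = "\<Pi>\<^sub>M j\<in>insert i A. exp_measure"
  have [measurable]: "comb_dens i A a \<in> borel_measurable borel" using A by measurable
  have S [measurable]: "?S \<in> borel_measurable ?P"
    using A by (intro borel_measurable_sum borel_measurable_times) (auto simp: exp_measure_def)
  have eq: "distr ?P borel ?S = density lborel (\<lambda>x. ennreal (enn2real (comb_dens i A a x)))"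
  proof (rule measure_eqI)
    fix X assume "X \<in> sets (distr ?P borel ?S)"
    then have [measurable]: "X \<in> sets borel" by simp
    have "emeasure (density lborel (\<lambda>x. ennreal (enn2real (comb_dens i A a x)))) X
      = (\<integral>\<^sup>+ u. indicator X u * comb_dens i A a u \<partial>lborel)"
      using A by (simp add: emeasure_density comb_dens_eq_ennreal[symmetric] mult.commute)
    also have "\<dots> = (\<integral>\<^sup>+ y. indicator X (?S y) \<partial>?P)"
      using A ai by (intro nn_integral_comb_dens) auto
    also have "\<dots> = emeasure (distr ?P borel ?S) X"
      by (simp add: nn_integral_distr flip: nn_integral_indicator)
    finally show "emeasure (distr ?P borel ?S) X
      = emeasure (density lborel (\<lambda>x. ennreal (enn2real (comb_dens i A a x)))) X" by simp
  qed simp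
  have "has_bochner_integral (distr ?P borel ?S) g M"
    using assms(5) by (simp add: has_bochner_integral_iff integrable_distr_eq integral_distr)
  then show ?thesis
    unfolding eq by (simp add: has_bochner_integral_iff integrable_density integral_density mult.commute)
qed

text \<open>
  A convolution with an exponential density is continuous although that density jumps at the
  origin, by dominated convergence: the jump is met for a single value of the integration
  variable.
\<close>

lemma continuous_on_comb_dens:
  assumes A: "finite A" "i \<notin> A" and ai: "a i \<noteq> 0" and j: "j \<in> A" "a j \<noteq> 0"
  shows "continuous_on UNIV (\<lambda>u. enn2real (comb_dens i A a u))"
proof -
  define B where "B = A - {j}"
  have B: "A = insert j B" "j \<notin> B" "finite B" "i \<notin> B" using A j by (auto simp: B_def)
  let ?k = "scaled_exp_dens (a j)" and ?f = "comb_dens i B a"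
  have [measurable]: "?f \<in> borel_measurable borel" using B by measurable
  have conv: "comb_dens i A a u = (\<integral>\<^sup>+ w. ?f w * ?k (u - w) \<partial>lborel)" for u
    using nn_integral_real_affine[of "\<lambda>w. ?f w * ?k (u - w)" "-1" u] j B
    by (simp add: comb_dens_insert_convolution)
  have kb: "?k x \<le> ennreal (1 / \<bar>a j\<bar>)" for x
    by (auto simp: scaled_exp_dens_def exp_dens_def indicator_def ennreal_mult'[symmetric] intro!: ennreal_leI
        divide_right_mono)
  have kc: "isCont ?k x" if "x \<noteq> 0" for x
  proof -
    define s where "s = (if 0 < x / a j then 1 else 0 :: real)"
    have xa: "x / a j \<noteq> 0" using that j by simp
    have "((\<lambda>t. t / a j) \<longlongrightarrow> x / a j) (at x)"
      using j by (intro tendsto_intros) auto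
    moreover define U where "U = (if 0 < x / a j then {0<..} else {..<0 :: real})"
    moreover have "open U" by (simp add: U_def)
    moreover have "x / a j \<in> U"
    proof (cases "0 < x / a j")
      case False
      then have "x / a j < 0" using xa by linarith
      then show ?thesis using False by (simp add: U_def)
    qed (simp add: U_def)
    ultimately have "eventually (\<lambda>t. t / a j \<in> U) (at x)"
      by (blast dest: topological_tendstoD)
    then have ev: "eventually (\<lambda>t. ennreal (1 / \<bar>a j\<bar>) * ennreal (exp (- (t / a j)) * s) = ?k t) (at x)"
      by (rule eventually_mono) (auto simp: U_def s_def scaled_exp_dens_def exp_dens_def indicator_def split: if_splits)
    have lim: "((\<lambda>t. ennreal (1 / \<bar>a j\<bar>) * ennreal (exp (- (t / a j)) * s))
        \<longlongrightarrow> ennreal (1 / \<bar>a j\<bar>) * ennreal (exp (- (x / a j)) * s)) (at x)"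
      using j by (intro ennreal_tendsto_cmult tendsto_ennrealI tendsto_intros) auto
    have eq: "ennreal (1 / \<bar>a j\<bar>) * ennreal (exp (- (x / a j)) * s) = ?k x"
      using xa by (simp add: scaled_exp_dens_def exp_dens_def s_def indicator_def)
    from Lim_transform_eventually[OF lim ev] show ?thesis
      unfolding isCont_def eq .
  qed
  have "(\<lambda>n. comb_dens i A a (X n)) \<longlonglongrightarrow> comb_dens i A a u" if X: "X \<longlonglongrightarrow> u" for X u
    unfolding conv
  proof (rule nn_integral_dominated_convergence[where w = "\<lambda>w. ?f w * ennreal (1 / \<bar>a j\<bar>)"])
    show "AE w in lborel. ?f w * ?k (X n - w) \<le> ?f w * ennreal (1 / \<bar>a j\<bar>)" for n
      by (intro always_eventually allI mult_left_mono kb) simp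
    have "(\<integral>\<^sup>+ w. ?f w \<partial>lborel) = 1"
      using nn_integral_comb_dens[OF B(3,4), of a,
          OF ai, of "\<lambda>_. 1"]
        prob_space.emeasure_space_1[OF prob_space_exp_prod] by simp
    then show "(\<integral>\<^sup>+ w. ?f w * ennreal (1 / \<bar>a j\<bar>) \<partial>lborel) < \<infinity>"
      by (simp add: nn_integral_multc)
    show "AE w in lborel. (\<lambda>n. ?f w * ?k (X n - w)) \<longlonglongrightarrow> ?f w * ?k (u - w)"
      using AE_lborel_singleton[of u]
    proof eventually_elim
      case (elim w)
      have "(\<lambda>n. ?k (X n - w)) \<longlonglongrightarrow> ?k (u - w)"
        using elim by (intro isCont_tendsto_compose[OF kc] tendsto_intros X) auto
      then show ?case
        using le_less_trans[OF comb_dens_le[OF B(3)] ennreal_less_top] by (intro ennreal_tendsto_cmult) auto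
    qed
  qed measurable
  then have "isCont (comb_dens i A a) u" for u
    by (simp add: continuous_at_sequentially comp_def)
  then have "isCont (\<lambda>u. enn2real (comb_dens i A a u)) u" for u
    unfolding isCont_def
    using tendsto_enn2real[of "comb_dens i A a" "enn2real (comb_dens i A a u)" "at u"]
      comb_dens_eq_ennreal[OF A(1), of i a u] by simp
  then show ?thesis by (simp add: continuous_on_eq_continuous_at)
qed

lemma exp_prod_integral_prod:
  fixes h :: "'i \<Rightarrow> real \<Rightarrow> real"
  assumes "finite I" "\<And>l. l \<in> I \<Longrightarrow> has_bochner_integral exp_measure (h l) (v l)"
  shows "has_bochner_integral (\<Pi>\<^sub>M j\<in>I. exp_measure) (\<lambda>y. \<Prod>l\<in>I. h l (y l)) (\<Prod>l\<in>I. v l)"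
  using assms exp_prod.product_integrable_prod[of I h] exp_prod.product_integral_prod[of I h]
  by (simp add: has_bochner_integral_iff)

lemma exp_prod_second_moments:
  assumes I: "finite I" "i \<in> I" "j \<in> I"
  shows "has_bochner_integral (\<Pi>\<^sub>M j\<in>I. exp_measure) (\<lambda>y. y i * y j) (if i = j then 2 else 1)"
proof -
  define e where "e l = (if l = i then 1 else 0) + (if l = j then 1 else 0 :: nat)" for l
  have "has_bochner_integral (\<Pi>\<^sub>M j\<in>I. exp_measure) (\<lambda>y. \<Prod>l\<in>I. y l ^ e l) (\<Prod>l\<in>I. fact (e l))"
    by (intro exp_prod_integral_prod I exp_measure_power)
  moreover have "(\<Prod>l\<in>I. y l ^ e l) = y i * y j" for y :: "_ \<Rightarrow> real"
    using I by (simp add: e_def power_add prod.distrib if_distrib[of "\<lambda>n. _ ^ n"] cong: if_cong)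
  moreover have "(\<Prod>l\<in>I. fact (e l)) = (if i = j then 2 else 1 :: real)"
  proof -
    have "(\<Prod>l\<in>I. fact (e l) :: real) = (\<Prod>l\<in>I. if l = i then (if i = j then 2 else 1) else 1)"
      by (intro prod.cong) (auto simp: e_def)
    also have "\<dots> = (if i = j then 2 else 1)" using I by simp
    finally show ?thesis .
  qed
  ultimately show ?thesis by (simp only:)
qed

lemma exp_prod_first_moments:
  assumes I: "finite I" "i \<in> I"
  shows "has_bochner_integral (\<Pi>\<^sub>M j\<in>I. exp_measure) (\<lambda>y. y i) 1"
proof -
  define e where "e l = (if l = i then 1 else 0 :: nat)" for l
  have "has_bochner_integral (\<Pi>\<^sub>M j\<in>I. exp_measure) (\<lambda>y. \<Prod>l\<in>I. y l ^ e l) (\<Prod>l\<in>I. fact (e l))"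
    by (intro exp_prod_integral_prod I exp_measure_power)
  moreover have "(\<Prod>l\<in>I. y l ^ e l) = y i" for y :: "_ \<Rightarrow> real"
    using I by (simp add: e_def if_distrib[of "\<lambda>n. _ ^ n"] cong: if_cong)
  moreover have "(\<Prod>l\<in>I. fact (e l)) = (1 :: real)"
    by (intro prod.neutral) (simp add: e_def)
  ultimately show ?thesis by (simp only:)
qed

lemma exp_prod_comb_moments:
  fixes a :: "'i \<Rightarrow> real"
  assumes I: "finite I"
  shows "has_bochner_integral (\<Pi>\<^sub>M j\<in>I. exp_measure) (\<lambda>y. \<Sum>j\<in>I. a j * y j) (\<Sum>j\<in>I. a j)"
    and "has_bochner_integral (\<Pi>\<^sub>M j\<in>I. exp_measure) (\<lambda>y. (\<Sum>j\<in>I. a j * y j)\<^sup>2)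
           ((\<Sum>j\<in>I. a j)\<^sup>2 + (\<Sum>j\<in>I. (a j)\<^sup>2))"
proof -
  have "has_bochner_integral (\<Pi>\<^sub>M j\<in>I. exp_measure) (\<lambda>y. \<Sum>j\<in>I. a j * y j) (\<Sum>j\<in>I. a j * 1)"
    by (intro has_bochner_integral_sum has_bochner_integral_mult_right exp_prod_first_moments I) auto
  then show "has_bochner_integral (\<Pi>\<^sub>M j\<in>I. exp_measure) (\<lambda>y. \<Sum>j\<in>I. a j * y j) (\<Sum>j\<in>I. a j)"
    by simp
  have "has_bochner_integral (\<Pi>\<^sub>M j\<in>I. exp_measure) (\<lambda>y. \<Sum>i\<in>I. \<Sum>j\<in>I. (a i * a j) * (y i * y j))
      (\<Sum>i\<in>I. \<Sum>j\<in>I. (a i * a j) * (if i = j then 2 else 1))"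
    by (intro has_bochner_integral_sum has_bochner_integral_mult_right exp_prod_second_moments I) auto
  moreover have "(\<Sum>i\<in>I. \<Sum>j\<in>I. (a i * a j) * (y i * y j)) = (\<Sum>j\<in>I. a j * y j)\<^sup>2" for y
    by (simp add: power2_eq_square sum_product mult_ac)
  moreover have "(\<Sum>i\<in>I. \<Sum>j\<in>I. (a i * a j) * (if i = j then 2 else 1)) = (\<Sum>j\<in>I. a j)\<^sup>2 + (\<Sum>j\<in>I. (a j)\<^sup>2)"
  proof -
    have "(\<Sum>i\<in>I. \<Sum>j\<in>I. (a i * a j) * (if i = j then 2 else 1))
      = (\<Sum>i\<in>I. \<Sum>j\<in>I. a i * a j + (if i = j then a i * a j else 0))"
      by (intro sum.cong) auto
    then show ?thesis using I by (simp add: sum.distrib power2_eq_square sum_product)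
  qed
  ultimately show "has_bochner_integral (\<Pi>\<^sub>M j\<in>I. exp_measure) (\<lambda>y. (\<Sum>j\<in>I. a j * y j)\<^sup>2)
           ((\<Sum>j\<in>I. a j)\<^sup>2 + (\<Sum>j\<in>I. (a j)\<^sup>2))" by (simp only:)
qed

section \<open>Lebesgue measure in orthonormal coordinates\<close>

interpretation lborel_prod: product_sigma_finite "\<lambda>_. lborel :: real measure"
  by standard

lemma sigma_finite_lborel_prod: "finite I \<Longrightarrow> sigma_finite_measure (\<Pi>\<^sub>M i\<in>I. lborel :: real measure)"
  by (rule lborel_prod.sigma_finite)

lemma lin_comb_measurable [measurable]:
  fixes u :: "'i \<Rightarrow> 'a::euclidean_space"
  shows "(\<lambda>t. \<Sum>i\<in>I. t i *\<^sub>R u i) \<in> borel_measurable (\<Pi>\<^sub>M i\<in>I. lborel)"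
  by measurable

text \<open>
  Translations and dilations of the coordinates, one coordinate at a time.
\<close>

lemma nn_integral_lin_comb_affine:
  fixes u :: "'i \<Rightarrow> 'a::euclidean_space" and r :: real
  assumes "finite I" and [measurable]: "H \<in> borel_measurable borel" and r: "r \<noteq> 0"
  shows "(\<integral>\<^sup>+ t. H (\<Sum>i\<in>I. t i *\<^sub>R u i) \<partial>(\<Pi>\<^sub>M i\<in>I. lborel))
    = ennreal (\<bar>r\<bar> ^ card I) * (\<integral>\<^sup>+ t. H (\<Sum>i\<in>I. (c i + r * t i) *\<^sub>R u i) \<partial>(\<Pi>\<^sub>M i\<in>I. lborel))"
  using assms(1,2)
proof (induction I arbitrary: H rule: finite_induct)
  case (insert i I)
  note [measurable] = insert.prems
  interpret I: sigma_finite_measure "\<Pi>\<^sub>M i\<in>I. lborel :: real measure"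
    using insert.hyps by (intro sigma_finite_lborel_prod)
  define K where "K v = (\<integral>\<^sup>+ y. H ((c i + r * y) *\<^sub>R u i + v) \<partial>lborel)" for v
  have [measurable]: "K \<in> borel_measurable borel" unfolding K_def by measurable
  have upd: "(\<Sum>l\<in>insert i I. f ((t(i := y)) l) l) = f y i + (\<Sum>l\<in>I. f (t l) l)"
    for f :: "real \<Rightarrow> 'i \<Rightarrow> 'a" and t y
    using insert.hyps by (simp, intro sum.cong) auto
  have "(\<integral>\<^sup>+ t. H (\<Sum>i\<in>insert i I. t i *\<^sub>R u i) \<partial>(\<Pi>\<^sub>M i\<in>insert i I. lborel))
      = (\<integral>\<^sup>+ t. \<integral>\<^sup>+ y. H (y *\<^sub>R u i + (\<Sum>l\<in>I. t l *\<^sub>R u l)) \<partial>lborel \<partial>(\<Pi>\<^sub>M i\<in>I. lborel))"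
    using insert.hyps upd[of "\<lambda>x l. x *\<^sub>R u l"]
    by (subst lborel_prod.product_nn_integral_insert) simp_all
  also have "\<dots> = (\<integral>\<^sup>+ t. ennreal \<bar>r\<bar> * K (\<Sum>l\<in>I. t l *\<^sub>R u l) \<partial>(\<Pi>\<^sub>M i\<in>I. lborel))"
    unfolding K_def using r by (intro nn_integral_cong nn_integral_real_affine) auto
  also have "\<dots> = ennreal \<bar>r\<bar> * (\<integral>\<^sup>+ t. K (\<Sum>l\<in>I. t l *\<^sub>R u l) \<partial>(\<Pi>\<^sub>M i\<in>I. lborel))"
    by (rule nn_integral_cmult) measurable
  also have "\<dots> = ennreal \<bar>r\<bar> * (ennreal (\<bar>r\<bar> ^ card I) *
      (\<integral>\<^sup>+ t. K (\<Sum>l\<in>I. (c l + r * t l) *\<^sub>R u l) \<partial>(\<Pi>\<^sub>M i\<in>I. lborel)))"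
    by (subst insert.IH) simp_all
  also have "\<dots> = ennreal (\<bar>r\<bar> ^ card (insert i I)) *
      (\<integral>\<^sup>+ t. K (\<Sum>l\<in>I. (c l + r * t l) *\<^sub>R u l) \<partial>(\<Pi>\<^sub>M i\<in>I. lborel))"
    using insert.hyps by (simp add: ennreal_mult' mult.assoc)
  also have "(\<integral>\<^sup>+ t. K (\<Sum>l\<in>I. (c l + r * t l) *\<^sub>R u l) \<partial>(\<Pi>\<^sub>M i\<in>I. lborel))
      = (\<integral>\<^sup>+ t. H (\<Sum>l\<in>insert i I. (c l + r * t l) *\<^sub>R u l) \<partial>(\<Pi>\<^sub>M i\<in>insert i I. lborel))"
    using insert.hyps upd[of "\<lambda>x l. (c l + r * x) *\<^sub>R u l"] unfolding K_def
    by (subst lborel_prod.product_nn_integral_insert) simp_all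
  finally show ?case .
qed simp

text \<open>
  Orthonormality together with completeness, stated as the expansion formula so that it can
  be used for an arbitrary index set.
\<close>

definition orthonormal_basis_on :: "'i set \<Rightarrow> ('i \<Rightarrow> 'a::euclidean_space) \<Rightarrow> bool" where
  "orthonormal_basis_on I u \<longleftrightarrow> finite I \<and> (\<forall>i\<in>I. \<forall>j\<in>I. u i \<bullet> u j = (if i = j then 1 else 0)) \<and>
     (\<forall>x. (\<Sum>i\<in>I. (x \<bullet> u i) *\<^sub>R u i) = x)"

lemma nn_integral_lin_comb_translate:
  fixes u :: "'i \<Rightarrow> 'a::euclidean_space"
  assumes I: "finite I" and [measurable]: "H \<in> borel_measurable borel" and x: "x = (\<Sum>i\<in>I. c i *\<^sub>R u i)"
  shows "(\<integral>\<^sup>+ t. H ((\<Sum>i\<in>I. t i *\<^sub>R u i) + x) \<partial>(\<Pi>\<^sub>M i\<in>I. lborel))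
    = (\<integral>\<^sup>+ t. H (\<Sum>i\<in>I. t i *\<^sub>R u i) \<partial>(\<Pi>\<^sub>M i\<in>I. lborel))"
  using nn_integral_lin_comb_affine[OF I assms(2), of 1 u c]
  by (simp add: x scaleR_add_left sum.distrib add.commute)

lemma orthonormal_norm_square:
  assumes "finite I" "\<forall>i\<in>I. \<forall>j\<in>I. u i \<bullet> u j = (if i = j then 1 else 0)"
  shows "(norm (\<Sum>i\<in>I. t i *\<^sub>R u i))\<^sup>2 = (\<Sum>i\<in>I. (t i)\<^sup>2)"
proof -
  have "(norm (\<Sum>i\<in>I. t i *\<^sub>R u i))\<^sup>2 = (\<Sum>i\<in>I. \<Sum>j\<in>I. t i * t j * (u i \<bullet> u j))"
    by (simp add: power2_norm_eq_inner inner_sum_left inner_sum_right sum_distrib_left inner_commute mult_ac)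
  also have "\<dots> = (\<Sum>i\<in>I. \<Sum>j\<in>I. if i = j then t i * t j else 0)"
    using assms(2) by (intro sum.cong) auto
  finally show ?thesis using assms(1) by (simp add: power2_eq_square)
qed

text \<open>
  In orthonormal coordinates the Gaussian splits into one-dimensional ones.
\<close>

lemma nn_integral_gauss_orthonormal:
  fixes u :: "'i \<Rightarrow> 'a::euclidean_space"
  assumes u: "orthonormal_basis_on I u"
  shows "(\<integral>\<^sup>+ t. ennreal ((1 / sqrt (2 * pi)) ^ card I * exp (- (norm (\<Sum>i\<in>I. t i *\<^sub>R u i))\<^sup>2 / 2))
     \<partial>(\<Pi>\<^sub>M i\<in>I. lborel)) = 1"
proof -
  have fin: "finite I" using u by (simp add: orthonormal_basis_on_def)
  have "ennreal ((1 / sqrt (2 * pi)) ^ card I * exp (- (norm (\<Sum>i\<in>I. t i *\<^sub>R u i))\<^sup>2 / 2))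
      = (\<Prod>i\<in>I. ennreal (std_normal_density (t i)))" for t
  proof -
    have "(\<Prod>i\<in>I. std_normal_density (t i)) = (1 / sqrt (2 * pi)) ^ card I * exp (\<Sum>i\<in>I. - (t i)\<^sup>2 / 2)"
      using fin by (simp add: std_normal_density_def prod.distrib exp_sum prod_dividef power_divide)
    also have "(\<Sum>i\<in>I. - (t i)\<^sup>2 / 2) = - (norm (\<Sum>i\<in>I. t i *\<^sub>R u i))\<^sup>2 / 2"
      using u by (subst orthonormal_norm_square)
        (auto simp: orthonormal_basis_on_def sum_negf sum_divide_distrib)
    finally show ?thesis by (simp add: prod_ennreal)
  qed
  moreover have "(\<integral>\<^sup>+ x. ennreal (std_normal_density x) \<partial>lborel) = 1"
  proof -
    interpret prob_space "density lborel (\<lambda>x. ennreal (std_normal_density x))"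
      by (rule prob_space_normal_density) simp
    show ?thesis using emeasure_space_1 by (simp add: emeasure_density)
  qed
  ultimately show ?thesis
    using lborel_prod.product_nn_integral_prod[OF fin, of "\<lambda>_ x. ennreal (std_normal_density x)"] by simp
qed

text \<open>
  Lebesgue measure does not depend on the orthonormal basis. This is the uniqueness argument
  for Haar measure: both measures are translation invariant, so by Fubini the double
  integrals of \<open>H (U t) * \<rho> (W s)\<close> and \<open>H (W s) * \<rho> (W s - U t)\<close> agree for any
  weight \<open>\<rho>\<close>, and the Gaussian weight shows that the normalisations agree.
\<close>

lemma nn_integral_orthonormal_basis_unique:
  fixes u :: "'i \<Rightarrow> 'a::euclidean_space" and v :: "'j \<Rightarrow> 'a"
  assumes u: "orthonormal_basis_on I u" and v: "orthonormal_basis_on J v" and card: "card I = card J"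
    and [measurable]: "H \<in> borel_measurable borel"
  shows "(\<integral>\<^sup>+ t. H (\<Sum>i\<in>I. t i *\<^sub>R u i) \<partial>(\<Pi>\<^sub>M i\<in>I. lborel))
       = (\<integral>\<^sup>+ s. H (\<Sum>j\<in>J. s j *\<^sub>R v j) \<partial>(\<Pi>\<^sub>M j\<in>J. lborel))"
proof -
  have fin: "finite I" "finite J" using u v by (auto simp: orthonormal_basis_on_def)
  interpret I: sigma_finite_measure "\<Pi>\<^sub>M i\<in>I. lborel :: real measure"
    using fin by (intro sigma_finite_lborel_prod)
  interpret J: sigma_finite_measure "\<Pi>\<^sub>M j\<in>J. lborel :: real measure"
    using fin by (intro sigma_finite_lborel_prod)
  interpret IJ: pair_sigma_finite "\<Pi>\<^sub>M i\<in>I. lborel :: real measure" "\<Pi>\<^sub>M j\<in>J. lborel :: real measure" ..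
  define U where "U t = (\<Sum>i\<in>I. t i *\<^sub>R u i)" for t
  define W where "W s = (\<Sum>j\<in>J. s j *\<^sub>R v j)" for s
  have [measurable]: "U \<in> borel_measurable (\<Pi>\<^sub>M i\<in>I. lborel)" "W \<in> borel_measurable (\<Pi>\<^sub>M j\<in>J. lborel)"
    unfolding U_def W_def by measurable
  \<comment> \<open>The Gaussian is even and has total mass one with respect to both measures.\<close>
  define \<rho> where "\<rho> x = ennreal ((1 / sqrt (2 * pi)) ^ card I * exp (- (norm x)\<^sup>2 / 2))" for x :: 'a
  have [measurable]: "\<rho> \<in> borel_measurable borel" unfolding \<rho>_def by measurable
  have transU: "(\<integral>\<^sup>+ t. G (U t + x) \<partial>(\<Pi>\<^sub>M i\<in>I. lborel)) = (\<integral>\<^sup>+ t. G (U t) \<partial>(\<Pi>\<^sub>M i\<in>I. lborel))"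
    if "G \<in> borel_measurable borel" for G :: "'a \<Rightarrow> ennreal" and x
    unfolding U_def using u that fin
    by (intro nn_integral_lin_comb_translate[where c = "\<lambda>i. x \<bullet> u i"]) (auto simp: orthonormal_basis_on_def)
  have transW: "(\<integral>\<^sup>+ s. G (W s + x) \<partial>(\<Pi>\<^sub>M j\<in>J. lborel)) = (\<integral>\<^sup>+ s. G (W s) \<partial>(\<Pi>\<^sub>M j\<in>J. lborel))"
    if "G \<in> borel_measurable borel" for G :: "'a \<Rightarrow> ennreal" and x
    unfolding W_def using v that fin
    by (intro nn_integral_lin_comb_translate[where c = "\<lambda>i. x \<bullet> v i"]) (auto simp: orthonormal_basis_on_def)
  have gaussU: "(\<integral>\<^sup>+ t. \<rho> (U t) \<partial>(\<Pi>\<^sub>M i\<in>I. lborel)) = 1"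
    unfolding \<rho>_def U_def by (rule nn_integral_gauss_orthonormal[OF u])
  have gaussW: "(\<integral>\<^sup>+ s. \<rho> (W s) \<partial>(\<Pi>\<^sub>M j\<in>J. lborel)) = 1"
    unfolding \<rho>_def W_def card by (rule nn_integral_gauss_orthonormal[OF v])
  have even: "\<rho> (x - y) = \<rho> (y - x)" for x y by (simp add: \<rho>_def norm_minus_commute)
  have "(\<integral>\<^sup>+ t. H (U t) \<partial>(\<Pi>\<^sub>M i\<in>I. lborel))
      = (\<integral>\<^sup>+ t. \<integral>\<^sup>+ s. H (U t) * \<rho> (W s) \<partial>(\<Pi>\<^sub>M j\<in>J. lborel) \<partial>(\<Pi>\<^sub>M i\<in>I. lborel))"
    by (simp add: nn_integral_cmult gaussW)
  also have "\<dots> = (\<integral>\<^sup>+ s. \<integral>\<^sup>+ t. H (U t) * \<rho> (W s) \<partial>(\<Pi>\<^sub>M i\<in>I. lborel) \<partial>(\<Pi>\<^sub>M j\<in>J. lborel))"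
    by (rule IJ.Fubini'[symmetric]) measurable
  also have "\<dots> = (\<integral>\<^sup>+ s. \<integral>\<^sup>+ t. H (U t + W s) * \<rho> (W s) \<partial>(\<Pi>\<^sub>M i\<in>I. lborel) \<partial>(\<Pi>\<^sub>M j\<in>J. lborel))"
    by (intro nn_integral_cong transU[where G = "\<lambda>x. H x * c" for c, symmetric]) measurable
  also have "\<dots> = (\<integral>\<^sup>+ t. \<integral>\<^sup>+ s. H (U t + W s) * \<rho> (W s) \<partial>(\<Pi>\<^sub>M j\<in>J. lborel) \<partial>(\<Pi>\<^sub>M i\<in>I. lborel))"
    by (rule IJ.Fubini') measurable
  also have "\<dots> = (\<integral>\<^sup>+ t. \<integral>\<^sup>+ s. H (W s) * \<rho> (W s - U t) \<partial>(\<Pi>\<^sub>M j\<in>J. lborel) \<partial>(\<Pi>\<^sub>M i\<in>I. lborel))"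
  proof (rule nn_integral_cong)
    fix t
    show "(\<integral>\<^sup>+ s. H (U t + W s) * \<rho> (W s) \<partial>(\<Pi>\<^sub>M j\<in>J. lborel))
        = (\<integral>\<^sup>+ s. H (W s) * \<rho> (W s - U t) \<partial>(\<Pi>\<^sub>M j\<in>J. lborel))"
      using transW[of "\<lambda>x. H (U t + x) * \<rho> x" "- U t"] by simp
  qed
  also have "\<dots> = (\<integral>\<^sup>+ s. \<integral>\<^sup>+ t. H (W s) * \<rho> (W s - U t) \<partial>(\<Pi>\<^sub>M i\<in>I. lborel) \<partial>(\<Pi>\<^sub>M j\<in>J. lborel))"
    by (rule IJ.Fubini'[symmetric]) measurable
  also have "\<dots> = (\<integral>\<^sup>+ s. H (W s) \<partial>(\<Pi>\<^sub>M j\<in>J. lborel))"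
  proof (intro nn_integral_cong)
    fix s
    have "(\<integral>\<^sup>+ t. \<rho> (W s - U t) \<partial>(\<Pi>\<^sub>M i\<in>I. lborel)) = 1"
      using transU[of \<rho> "- W s"] gaussU by (simp add: even[of "W s"])
    then show "(\<integral>\<^sup>+ t. H (W s) * \<rho> (W s - U t) \<partial>(\<Pi>\<^sub>M i\<in>I. lborel)) = H (W s)"
      by (simp add: nn_integral_cmult)
  qed
  finally show ?thesis unfolding U_def W_def .
qed

section \<open>The simplex section as a density\<close>

lemma nn_integral_exp_prod:
  assumes "finite A" and "f \<in> borel_measurable (\<Pi>\<^sub>M j\<in>A. borel)"
  shows "(\<integral>\<^sup>+ y. f y \<partial>(\<Pi>\<^sub>M j\<in>A. exp_measure))
     = (\<integral>\<^sup>+ y. f y * (\<Prod>j\<in>A. exp_dens (y j)) \<partial>(\<Pi>\<^sub>M j\<in>A. lborel))"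
  using assms
proof (induction A arbitrary: f rule: finite_induct)
  case (insert i A)
  have cong [measurable_cong]: "sets (\<Pi>\<^sub>M j\<in>B. exp_measure) = sets (\<Pi>\<^sub>M j\<in>B. borel)"
      "sets (\<Pi>\<^sub>M j\<in>B. lborel :: real measure) = sets (\<Pi>\<^sub>M j\<in>B. borel)" for B :: "'a set"
    by (intro sets_PiM_cong; simp)+
  note [measurable] = insert.prems
  have [measurable]: "f \<in> borel_measurable (\<Pi>\<^sub>M j\<in>insert i A. exp_measure)"
      "f \<in> borel_measurable (\<Pi>\<^sub>M j\<in>insert i A. lborel)"
    by measurable
  have upd: "(\<Prod>j\<in>A. exp_dens (if j = i then t else y j)) = (\<Prod>j\<in>A. exp_dens (y j))" for y t
    using insert.hyps by (intro prod.cong) auto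
  interpret sigma_finite_measure "lborel :: real measure" by standard
  define g where "g y = (\<integral>\<^sup>+ t. f (y(i := t)) * exp_dens t \<partial>lborel)" for y
  have [measurable]: "g \<in> borel_measurable (\<Pi>\<^sub>M j\<in>A. borel)"
    unfolding g_def by measurable
  have "(\<integral>\<^sup>+ y. f y \<partial>(\<Pi>\<^sub>M j\<in>insert i A. exp_measure))
      = (\<integral>\<^sup>+ y. \<integral>\<^sup>+ t. f (y(i := t)) \<partial>exp_measure \<partial>(\<Pi>\<^sub>M j\<in>A. exp_measure))"
    using insert.hyps by (intro exp_prod.product_nn_integral_insert) auto
  also have "\<dots> = (\<integral>\<^sup>+ y. g y \<partial>(\<Pi>\<^sub>M j\<in>A. exp_measure))"
  proof (intro nn_integral_cong)
    fix y assume "y \<in> space (\<Pi>\<^sub>M j\<in>A. exp_measure)"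
    then have [measurable]: "y \<in> space (\<Pi>\<^sub>M j\<in>A. borel)" by (simp add: space_PiM)
    have "(\<lambda>t. f (y(i := t))) \<in> borel_measurable borel" by measurable
    then show "(\<integral>\<^sup>+ t. f (y(i := t)) \<partial>exp_measure) = g y"
      unfolding g_def exp_measure_def by (subst nn_integral_density) (auto simp: mult.commute)
  qed
  also have "\<dots> = (\<integral>\<^sup>+ y. g y * (\<Prod>j\<in>A. exp_dens (y j)) \<partial>(\<Pi>\<^sub>M j\<in>A. lborel))"
    by (rule insert.IH) measurable
  also have "\<dots> = (\<integral>\<^sup>+ y. \<integral>\<^sup>+ t. f (y(i := t)) * (\<Prod>j\<in>insert i A. exp_dens ((y(i := t)) j)) \<partial>lborel \<partial>(\<Pi>\<^sub>M j\<in>A. lborel))"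
  proof (intro nn_integral_cong)
    fix y assume "y \<in> space (\<Pi>\<^sub>M j\<in>A. lborel :: real measure)"
    then have [measurable]: "y \<in> space (\<Pi>\<^sub>M j\<in>A. borel)" by (simp add: space_PiM)
    have [measurable]: "(\<lambda>t. f (y(i := t))) \<in> borel_measurable borel" by measurable
    have "(\<Prod>j\<in>insert i A. exp_dens ((y(i := t)) j)) = exp_dens t * (\<Prod>j\<in>A. exp_dens (y j))" for t
      using insert.hyps by (simp add: upd)
    then show "g y * (\<Prod>j\<in>A. exp_dens (y j))
        = (\<integral>\<^sup>+ t. f (y(i := t)) * (\<Prod>j\<in>insert i A. exp_dens ((y(i := t)) j)) \<partial>lborel)"
      unfolding g_def by (subst nn_integral_multc[symmetric]) (auto simp: mult_ac)
  qed
  also have "\<dots> = (\<integral>\<^sup>+ y. f y * (\<Prod>j\<in>insert i A. exp_dens (y j)) \<partial>(\<Pi>\<^sub>M j\<in>insert i A. lborel))"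
    using insert.hyps by (intro lborel_prod.product_nn_integral_insert[symmetric]) auto
  finally show ?case .
qed (simp add: PiM_empty)

text \<open>
  The joint density of independent standard exponential variables.
\<close>

definition orthant_exp :: "real ^ 'n \<Rightarrow> ennreal" where
  "orthant_exp x = (\<Prod>j\<in>UNIV. exp_dens (x $ j))"

lemma orthant_exp_measurable [measurable]: "orthant_exp \<in> borel_measurable borel"
proof -
  have [measurable]: "(\<lambda>x :: real ^ 'n. x $ j) \<in> borel_measurable borel" for j
    by (intro borel_measurable_continuous_onI continuous_intros)
  show ?thesis unfolding orthant_exp_def by measurable
qed

lemma orthant_exp_eq:
  "orthant_exp x = ennreal (exp (- (\<Sum>j\<in>UNIV. x $ j))) * indicator {x. \<forall>j. 0 \<le> x $ j} x"
proof (cases "\<forall>j. 0 \<le> x $ j")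
  case True
  then have "orthant_exp x = (\<Prod>j\<in>UNIV. ennreal (exp (- (x $ j))))"
    by (simp add: orthant_exp_def exp_dens_def)
  also have "\<dots> = ennreal (exp (\<Sum>j\<in>UNIV. - (x $ j)))"
    by (simp add: prod_ennreal exp_sum)
  finally show ?thesis using True by (simp add: sum_negf)
next
  case False
  then obtain j where "x $ j < 0" by (auto simp: not_le)
  then have "exp_dens (x $ j) = 0" by (simp add: exp_dens_def)
  then have "orthant_exp x = 0" unfolding orthant_exp_def by (intro prod_zero) auto
  then show ?thesis using False by simp
qed

lemma orthonormal_basis_axis: "orthonormal_basis_on UNIV (\<lambda>j. axis j 1 :: real ^ 'n)"
  using basis_expansion[where 'a = real and 'n = 'n]
  by (auto simp: orthonormal_basis_on_def inner_axis inner_axis_axis scalar_mult_eq_scaleR)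
       (simp add: axis_def)

text \<open>
  The joint density evaluated at the projection of \<open>x\<close> to the hyperplane \<open>a \<bullet> x = 0\<close>
  along the \<open>i\<close>-th axis, restricted to a slab of unit width. Its integral over the whole
  space is computed below in the coordinate basis and in an orthonormal basis containing
  \<open>a\<close>. Since the evaluated density is constant along the axis, a slab of unit width serves
  in place of a limit of thin ones.
\<close>

definition slab_exp :: "real ^ 'n \<Rightarrow> 'n \<Rightarrow> real ^ 'n \<Rightarrow> ennreal" where
  "slab_exp a i x = orthant_exp (x - ((a \<bullet> x) / a $ i) *\<^sub>R axis i 1) * indicator {0..1} (a \<bullet> x)"

lemma slab_exp_measurable [measurable]: "slab_exp a i \<in> borel_measurable borel"
  unfolding slab_exp_def by measurable

text \<open>
  Along the \<open>i\<close>-th axis the integrand only sees the slab, which has width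
  \<open>1 / \<bar>a $ i\<bar>\<close> in that direction; the remaining integral is the density at \<open>0\<close> by
  definition.
\<close>

lemma slab_integral_axes:
  fixes a :: "real ^ 'n"
  assumes ai: "a $ i \<noteq> 0"
  shows "(\<integral>\<^sup>+ t. slab_exp a i (\<Sum>j\<in>UNIV. t j *\<^sub>R axis j 1) \<partial>(\<Pi>\<^sub>M j\<in>UNIV. lborel))
       = comb_dens i (UNIV - {i}) (($) a) 0"
proof -
  let ?z = "\<lambda>t :: 'n \<Rightarrow> real. (\<Sum>j\<in>UNIV. t j *\<^sub>R axis j 1) :: real ^ 'n"
  let ?A = "UNIV - {i}" and ?S = "\<lambda>y :: 'n \<Rightarrow> real. \<Sum>j\<in>UNIV - {i}. a $ j * y j"
  have ins: "UNIV = insert i ?A" by auto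
  have z: "?z t $ j = t j" for t j
    by (simp add: axis_def if_distrib[of "\<lambda>x. _ * x"] cong: if_cong)
  have az: "a \<bullet> ?z (y(i := x)) = ?S y + a $ i * x" for x y
  proof -
    have "a \<bullet> ?z (y(i := x)) = (\<Sum>j\<in>insert i ?A. a $ j * (y(i := x)) j)"
      unfolding inner_vec_def z ins[symmetric] by simp
    also have "\<dots> = a $ i * x + (\<Sum>j\<in>?A. a $ j * (y(i := x)) j)"
      by (subst sum.insert) auto
    also have "(\<Sum>j\<in>?A. a $ j * (y(i := x)) j) = ?S y"
      by (intro sum.cong) auto
    finally show ?thesis by simp
  qed
  have G: "orthant_exp (?z (y(i := x)) - ((a \<bullet> ?z (y(i := x))) / a $ i) *\<^sub>R axis i 1)
      = exp_dens (- ?S y / a $ i) * (\<Prod>j\<in>?A. exp_dens (y j))" for x y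
  proof -
    have "orthant_exp (?z (y(i := x)) - ((a \<bullet> ?z (y(i := x))) / a $ i) *\<^sub>R axis i 1)
        = (\<Prod>j\<in>insert i ?A. exp_dens ((y(i := x)) j - ((?S y + a $ i * x) / a $ i) * (if j = i then 1 else 0)))"
      unfolding orthant_exp_def ins[symmetric] az
      by (intro prod.cong refl arg_cong[where f = exp_dens])
         (simp only: vector_minus_component vector_scaleR_component z, simp add: axis_def)
    also have "\<dots> = exp_dens (x - (?S y + a $ i * x) / a $ i) * (\<Prod>j\<in>?A. exp_dens (y j))"
      by (subst prod.insert) (auto intro!: arg_cong2[where f = "(*)"] prod.cong)
    also have "x - (?S y + a $ i * x) / a $ i = - ?S y / a $ i"
      using ai by (simp add: field_simps)
    finally show ?thesis .
  qed
  have slab: "(\<integral>\<^sup>+ x. indicator {0..1} (s + a $ i * x) \<partial>lborel) = ennreal (1 / \<bar>a $ i\<bar>)" for s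
  proof -
    have "1 = ennreal \<bar>a $ i\<bar> * (\<integral>\<^sup>+ x. indicator {0..1} (s + a $ i * x) \<partial>lborel)"
      using nn_integral_real_affine[of "indicator {0..1} :: real \<Rightarrow> ennreal" "a $ i" s] ai by simp
    then have "ennreal (1 / \<bar>a $ i\<bar>) * 1 = (ennreal (1 / \<bar>a $ i\<bar>) * ennreal \<bar>a $ i\<bar>)
        * (\<integral>\<^sup>+ x. indicator {0..1} (s + a $ i * x) \<partial>lborel)"
      by (simp only: mult.assoc)
    then show ?thesis using ai by (simp add: ennreal_mult'[symmetric])
  qed
  have "(\<integral>\<^sup>+ t. slab_exp a i (?z t) \<partial>(\<Pi>\<^sub>M j\<in>UNIV. lborel))
      = (\<integral>\<^sup>+ y. \<integral>\<^sup>+ x. slab_exp a i (?z (y(i := x))) \<partial>lborel \<partial>(\<Pi>\<^sub>M j\<in>?A. lborel))"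
    using lborel_prod.product_nn_integral_insert[of ?A i "\<lambda>t. slab_exp a i (?z t)"]
    by (simp only: ins[symmetric]) (auto simp: ins[symmetric])
  also have "\<dots> = (\<integral>\<^sup>+ y. scaled_exp_dens (a $ i) (0 - ?S y) * (\<Prod>j\<in>?A. exp_dens (y j)) \<partial>(\<Pi>\<^sub>M j\<in>?A. lborel))"
  proof (rule nn_integral_cong)
    fix y
    have "(\<integral>\<^sup>+ x. slab_exp a i (?z (y(i := x))) \<partial>lborel)
        = (\<integral>\<^sup>+ x. exp_dens (- ?S y / a $ i) * (\<Prod>j\<in>?A. exp_dens (y j)) * indicator {0..1} (?S y + a $ i * x) \<partial>lborel)"
      by (simp only: slab_exp_def G) (simp only: az)
    also have "\<dots> = exp_dens (- ?S y / a $ i) * (\<Prod>j\<in>?A. exp_dens (y j)) * ennreal (1 / \<bar>a $ i\<bar>)"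
      by (subst nn_integral_cmult) (simp_all add: slab)
    finally show "(\<integral>\<^sup>+ x. slab_exp a i (?z (y(i := x))) \<partial>lborel)
        = scaled_exp_dens (a $ i) (0 - ?S y) * (\<Prod>j\<in>?A. exp_dens (y j))"
      by (simp add: scaled_exp_dens_def mult_ac)
  qed
  also have "\<dots> = comb_dens i ?A (($) a) 0"
    unfolding comb_dens_def
    by (rule nn_integral_exp_prod[symmetric]) auto
  finally show ?thesis .
qed

text \<open>
  For a unit vector \<open>a\<close> the slab contributes the factor one, and what remains is the
  integral of the exponential over the hyperplane itself.
\<close>

lemma slab_integral_orthonormal:
  fixes a :: "real ^ 'n"
  assumes ai: "a $ i \<noteq> 0" and v: "orthonormal_basis_on {..<Suc m} v" and va: "v m = a"
  shows "(\<integral>\<^sup>+ t. slab_exp a i (\<Sum>j<Suc m. t j *\<^sub>R v j) \<partial>(\<Pi>\<^sub>M j\<in>{..<Suc m}. lborel))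
       = (\<integral>\<^sup>+ t. orthant_exp (\<Sum>j<m. t j *\<^sub>R v j) \<partial>(\<Pi>\<^sub>M j\<in>{..<m}. lborel))"
    (is "_ = ?A")
proof -
  let ?z = "\<lambda>t. \<Sum>j<Suc m. t j *\<^sub>R v j"
  have orth: "v j \<bullet> v l = (if j = l then 1 else 0)" if "j \<le> m" "l \<le> m" for j l
    using v that by (auto simp: orthonormal_basis_on_def less_Suc_eq_le)
  have av: "a \<bullet> v j = 0" if "j < m" for j
    using orth[of m j] that by (auto simp: va)
  have aa: "a \<bullet> a = 1" using orth[of m m] by (simp add: va)
  \<comment> \<open>Sliding the slice \<open>a \<bullet> x = s\<close> back to \<open>s = 0\<close> along the axis moves
    it, relative to the orthogonal projection, by \<open>s\<close> times this vector of the hyperplane, which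
    a translation absorbs.\<close>
  define c where "c = a - (1 / a $ i) *\<^sub>R axis i 1"
  have "c \<bullet> a = 0" using ai aa by (simp add: c_def inner_diff_left inner_axis')
  moreover have "(\<Sum>j<Suc m. (c \<bullet> v j) *\<^sub>R v j) = c"
    using v by (simp add: orthonormal_basis_on_def)
  ultimately have c: "c = (\<Sum>j<m. (c \<bullet> v j) *\<^sub>R v j)" by (simp add: va)
  have z: "?z (t(m := s)) = s *\<^sub>R a + (\<Sum>j<m. t j *\<^sub>R v j)" for t s
    by (simp add: va add.commute)
  have az: "a \<bullet> ?z (t(m := s)) = s" for t s
    unfolding z by (simp add: inner_add_right inner_sum_right av aa)
  have F: "slab_exp a i (?z (t(m := s))) = orthant_exp ((\<Sum>j<m. t j *\<^sub>R v j) + s *\<^sub>R c) * indicator {0..1} s" for t s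
    unfolding slab_exp_def az unfolding z c_def by (simp add: algebra_simps)
  have "(\<integral>\<^sup>+ t. slab_exp a i (?z t) \<partial>(\<Pi>\<^sub>M j\<in>{..<Suc m}. lborel))
      = (\<integral>\<^sup>+ s. \<integral>\<^sup>+ t. slab_exp a i (?z (t(m := s))) \<partial>(\<Pi>\<^sub>M j\<in>{..<m}. lborel) \<partial>lborel)"
    using lborel_prod.product_nn_integral_insert_rev[of "{..<m}" m "\<lambda>t. slab_exp a i (?z t)"]
    by (simp only: lessThan_Suc[symmetric]) auto
  also have "\<dots> = (\<integral>\<^sup>+ s. ?A * indicator {0..1} (s :: real) \<partial>lborel)"
  proof (rule nn_integral_cong)
    fix s
    have "(\<integral>\<^sup>+ t. slab_exp a i (?z (t(m := s))) \<partial>(\<Pi>\<^sub>M j\<in>{..<m}. lborel))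
        = (\<integral>\<^sup>+ t. orthant_exp ((\<Sum>j<m. t j *\<^sub>R v j) + s *\<^sub>R c) \<partial>(\<Pi>\<^sub>M j\<in>{..<m}. lborel)) * indicator {0..1} s"
      unfolding F by (rule nn_integral_multc) measurable
    also have "(\<integral>\<^sup>+ t. orthant_exp ((\<Sum>j<m. t j *\<^sub>R v j) + s *\<^sub>R c) \<partial>(\<Pi>\<^sub>M j\<in>{..<m}. lborel)) = ?A"
      by (rule nn_integral_lin_comb_translate[where c = "\<lambda>j. s * (c \<bullet> v j)"])
         (auto simp: scaleR_sum_right[symmetric] scaleR_scaleR[symmetric] c[symmetric] simp del: scaleR_scaleR)
    finally show "(\<integral>\<^sup>+ t. slab_exp a i (?z (t(m := s))) \<partial>(\<Pi>\<^sub>M j\<in>{..<m}. lborel)) = ?A * indicator {0..1} s" .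
  qed
  also have "\<dots> = ?A" by (subst nn_integral_cmult) simp_all
  finally show ?thesis .
qed

text \<open>
  The measure on the affine subspace of the section is defined through a choice of frame;
  this makes the choice meaningful.
\<close>

lemma affine_frame_exists:
  fixes S :: "'a::euclidean_space set"
  assumes "subspace S"
  shows "\<exists>u. orthonormal_frame (dim S) ((+) p ` S) p u"
proof -
  obtain B where B: "B \<subseteq> S" "pairwise orthogonal B" "\<And>x. x \<in> B \<Longrightarrow> norm x = 1"
      "independent B" "card B = dim S" "span B = S"
    using orthonormal_basis_subspace[OF assms] by metis
  have fin: "finite B" using B(4) by (rule independent_imp_finite)
  obtain u where u: "bij_betw u {..<dim S} B"
    using ex_bij_betw_nat_finite[OF fin] B(5) by (auto simp: lessThan_atLeast0)
  have "u i \<bullet> u j = (if i = j then 1 else 0)" if "i < dim S" "j < dim S" for i j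
  proof (cases "i = j")
    case True
    have "u j \<in> B" using u that by (auto simp: bij_betw_def)
    then show ?thesis using True B(3)[of "u j"] by (simp add: dot_square_norm)
  next
    case False
    have "u i \<noteq> u j" using False u that by (auto simp: bij_betw_def inj_on_def)
    moreover have "u i \<in> B" "u j \<in> B" using u that by (auto simp: bij_betw_def)
    ultimately show ?thesis using B(2) False by (auto simp: pairwise_def orthogonal_def)
  qed
  moreover have "(+) p ` S = range (\<lambda>t. p + (\<Sum>i<dim S. t i *\<^sub>R u i))"
  proof -
    have "S = range (\<lambda>c. \<Sum>b\<in>B. c b *\<^sub>R b)"
      using span_finite[OF fin] B(6) by simp
    also have "\<dots> = range (\<lambda>t. \<Sum>i<dim S. t i *\<^sub>R u i)"
    proof (intro equalityI subsetI)
      fix x assume "x \<in> range (\<lambda>c. \<Sum>b\<in>B. c b *\<^sub>R b)"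
      then obtain c where "x = (\<Sum>b\<in>B. c b *\<^sub>R b)" by auto
      then have "x = (\<Sum>i<dim S. (c \<circ> u) i *\<^sub>R u i)"
        using sum.reindex_bij_betw[OF u, of "\<lambda>b. c b *\<^sub>R b"] by simp
      then show "x \<in> range (\<lambda>t. \<Sum>i<dim S. t i *\<^sub>R u i)" by blast
    next
      fix x assume "x \<in> range (\<lambda>t. \<Sum>i<dim S. t i *\<^sub>R u i)"
      then obtain t where t: "x = (\<Sum>i<dim S. t i *\<^sub>R u i)" by auto
      have "x \<in> span B"
        unfolding t using u by (intro span_sum span_mul span_base) (auto simp: bij_betw_def)
      then show "x \<in> range (\<lambda>c. \<Sum>b\<in>B. c b *\<^sub>R b)" using span_finite[OF fin] by simp
    qed
    finally have "(+) p ` S = (+) p ` range (\<lambda>t. \<Sum>i<dim S. t i *\<^sub>R u i)"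
      by (rule arg_cong)
    then show ?thesis by (simp only: image_image)
  qed
  ultimately show ?thesis unfolding orthonormal_frame_def by blast
qed

lemma dim_orthogonal_pair:
  fixes a b :: "'a::euclidean_space"
  assumes "independent {a, b}" "a \<noteq> b"
  shows "dim {x. a \<bullet> x = 0 \<and> b \<bullet> x = 0} + 2 = DIM('a)"
proof -
  have "dim {y \<in> UNIV. \<forall>x\<in>span {a, b}. orthogonal x y} + dim (span {a, b}) = dim (UNIV :: 'a set)"
    by (rule dim_subspace_orthogonal_to_vectors) (auto simp: subspace_span)
  moreover have "{y \<in> UNIV. \<forall>x\<in>span {a, b}. orthogonal x y} = {x. a \<bullet> x = 0 \<and> b \<bullet> x = 0}"
  proof (intro equalityI subsetI)
    fix y assume y: "y \<in> {x. a \<bullet> x = 0 \<and> b \<bullet> x = 0}"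
    have "orthogonal x y" if "x \<in> span {a, b}" for x
      using orthogonal_to_span[of x "{a, b}" y] that y by (auto simp: orthogonal_def inner_commute)
    then show "y \<in> {y \<in> UNIV. \<forall>x\<in>span {a, b}. orthogonal x y}" by auto
  qed (auto simp: orthogonal_def span_base)
  moreover have "dim (span {a, b}) = 2"
    using assms dim_eq_card_independent[OF assms(1)] by simp
  ultimately show ?thesis by simp
qed

text \<open>
  Slicing the hyperplane \<open>a \<bullet> x = 0\<close> by the coordinate sum \<open>r\<close>. The slice of the
  orthant is the simplex section dilated by \<open>r\<close>, of volume \<open>r ^ k\<close> times that of the
  section, and \<open>r\<close> varies by \<open>J\<close> per unit length orthogonally to the slices, where
  \<open>J = sqrt (k + 2 - K\<^sup>2)\<close>. Hence the exponential has integral \<open>1 / J\<close> times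
  \<open>\<integral> r ^ k * exp (- r) dr = fact k\<close> times the volume.
\<close>

lemma section_vol_slice:
  fixes a :: "real ^ 'n" and K :: real
  assumes a: "norm a = 1" "(\<Sum>j\<in>UNIV. a $ j) = K" and card: "CARD('n) = k + 2" and K: "K\<^sup>2 < real k + 2"
    and ai: "a $ i \<noteq> 0"
  shows "ennreal (sqrt (real k + 2 - K\<^sup>2)) * comb_dens i (UNIV - {i}) (($) a) 0
    = ennreal (fact k) * section_vol k a"
proof -
  define J where "J = sqrt (real k + 2 - K\<^sup>2)"
  have J: "0 < J" "J\<^sup>2 = real k + 2 - K\<^sup>2" using K by (auto simp: J_def)
  define one :: "real ^ 'n" where "one = (\<chi> j. 1)"
  have one: "one \<bullet> x = (\<Sum>j\<in>UNIV. x $ j)" for x by (simp add: one_def inner_vec_def)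
  have aa: "a \<bullet> a = 1" using a(1) by (simp add: dot_square_norm)
  have oa: "one \<bullet> a = K" "a \<bullet> one = K" using a(2) by (simp_all add: one inner_commute[of a])
  have oo: "one \<bullet> one = real k + 2" by (simp add: one) (simp add: one_def card)
  \<comment> \<open>The unit normal of the section within the hyperplane orthogonal to \<open>a\<close>; \<open>J\<close>
    is the square root of the Gram determinant of \<open>a\<close> and the all-one vector, and \<open>1 / J\<close> is the
    distance of the section's affine hull from the origin.\<close>
  define q where "q = (1 / J) *\<^sub>R (one - K *\<^sub>R a)"
  have qa: "q \<bullet> a = 0" "a \<bullet> q = 0"
    by (simp_all add: q_def inner_diff_left inner_diff_right oa aa)
  have "(one - K *\<^sub>R a) \<bullet> (one - K *\<^sub>R a) = J\<^sup>2"
    unfolding J by (simp add: inner_diff_left inner_diff_right oa aa oo power2_eq_square)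
  then have qq: "q \<bullet> q = 1" using J(1) by (simp add: q_def power2_eq_square)
  have oq: "one \<bullet> q = J"
  proof -
    have "one \<bullet> q = (1 / J) * J\<^sup>2"
      unfolding J(2) by (simp add: q_def inner_diff_right oa oo power2_eq_square)
    then show ?thesis using J(1) by (simp add: power2_eq_square)
  qed
  define p0 where "p0 = (1 / J) *\<^sub>R q"
  define E where "E = hyperplane a \<inter> (sum_one :: (real ^ 'n) set)"
  have E: "x \<in> E \<longleftrightarrow> a \<bullet> x = 0 \<and> one \<bullet> x = 1" for x
    by (simp add: E_def hyperplane_def sum_one_def one)
  have p0: "p0 \<in> E" using J(1) by (simp add: E p0_def qa oq)
  define S where "S = {x. a \<bullet> x = 0 \<and> one \<bullet> x = 0}"
  have "subspace S" unfolding S_def subspace_def by (auto simp: inner_add_right)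
  have "one \<noteq> c *\<^sub>R a" for c
  proof
    assume "one = c *\<^sub>R a"
    then have "q = ((c - K) / J) *\<^sub>R a" by (simp add: q_def scaleR_diff_left scaleR_diff_right diff_divide_distrib)
    then show False using qa qq by (metis aa inner_scaleR_left inner_zero_left mult.right_neutral scaleR_zero_left zero_neq_one)
  qed
  then have indep: "independent {a, one}" "a \<noteq> one"
    using aa by (auto simp: independent_insert span_singleton insert_commute[of a one]) (metis scaleR_one)
  have dimS: "dim S = k"
    using dim_orthogonal_pair[OF indep] card by (simp add: S_def)
  have "E = (+) p0 ` S"
  proof (intro equalityI subsetI)
    fix x assume "x \<in> E"
    then have "x - p0 \<in> S" using p0 by (simp add: E S_def inner_diff_right)
    then have "p0 + (x - p0) \<in> (+) p0 ` S" by blast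
    then show "x \<in> (+) p0 ` S" by simp
  qed (use p0 in \<open>auto simp: E S_def inner_add_right\<close>)
  then have ex: "\<exists>pu. case pu of (p, u) \<Rightarrow> orthonormal_frame k E p u"
    using affine_frame_exists[OF \<open>subspace S\<close>, of p0] dimS by auto
  obtain p u where some: "(SOME (p, u). orthonormal_frame k E p u) = (p, u)" by (cases "SOME (p, u). orthonormal_frame k E p u")
  have frame: "orthonormal_frame k E p u"
    using someI_ex[OF ex] by (simp add: some)
  have orth: "u i \<bullet> u j = (if i = j then 1 else 0)" if "i < k" "j < k" for i j
    using frame that by (auto simp: orthonormal_frame_def)
  have Eu: "x \<in> E \<longleftrightarrow> (\<exists>t. x = p + (\<Sum>i<k. t i *\<^sub>R u i))" for x
    using frame by (auto simp: orthonormal_frame_def)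
  have p: "p \<in> E" using Eu[of p] by (auto intro: exI[of _ "\<lambda>_. 0"])
  have upos: "a \<bullet> u j = 0" "one \<bullet> u j = 0" if "j < k" for j
  proof -
    have "p + (\<Sum>i<k. (if i = j then 1 else 0) *\<^sub>R u i) \<in> E"
      unfolding Eu by (intro exI[of _ "\<lambda>i. if i = j then 1 else 0"] refl)
    then have "p + u j \<in> E" using that by (simp add: if_distrib[of "\<lambda>c. c *\<^sub>R _"] cong: if_cong)
    then show "a \<bullet> u j = 0" "one \<bullet> u j = 0" using p by (auto simp: E inner_add_right)
  qed
  have expand: "y = (\<Sum>i<k. (y \<bullet> u i) *\<^sub>R u i)" if "a \<bullet> y = 0" "one \<bullet> y = 0" for y
  proof -
    have "p + y \<in> E" using p that by (simp add: E inner_add_right)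
    then obtain t where t: "y = (\<Sum>i<k. t i *\<^sub>R u i)" using Eu by auto
    have "y \<bullet> u j = t j" if "j < k" for j
    proof -
      have "y \<bullet> u j = (\<Sum>i<k. if i = j then t i else 0)"
        unfolding t inner_sum_left using that by (intro sum.cong) (auto simp: orth)
      then show ?thesis using that by simp
    qed
    then show ?thesis using t by simp
  qed
  define v where "v i = (if i < k then u i else if i = k then q else a)" for i
  have v: "orthonormal_basis_on {..<Suc (Suc k)} v"
    unfolding orthonormal_basis_on_def
  proof (intro conjI ballI allI)
    have uq: "q \<bullet> u j = 0" if "j < k" for j
      using upos[OF that] by (simp add: q_def inner_diff_left)
    show "v i \<bullet> v j = (if i = j then 1 else 0)" if "i \<in> {..<Suc (Suc k)}" "j \<in> {..<Suc (Suc k)}" for i j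
      using that by (auto simp: v_def orth qa qq aa upos uq upos(1)[unfolded inner_commute[of a]]
          uq[unfolded inner_commute[of q]])
    fix x :: "real ^ 'n"
    define y where "y = x - (x \<bullet> a) *\<^sub>R a - (x \<bullet> q) *\<^sub>R q"
    have "a \<bullet> y = 0" "q \<bullet> y = 0"
      by (simp_all add: y_def inner_diff_right aa qa qq inner_commute[of a x] inner_commute[of q x])
    then have "a \<bullet> y = 0" "one \<bullet> y = 0"
      using J(1) by (simp_all add: q_def inner_diff_left)
    from expand[OF this] have "y = (\<Sum>i<k. (y \<bullet> u i) *\<^sub>R u i)" .
    also have "\<dots> = (\<Sum>i<k. (x \<bullet> u i) *\<^sub>R u i)"
      by (intro sum.cong) (simp_all add: y_def inner_diff_left uq upos)
    finally have "x = (\<Sum>i<k. (x \<bullet> u i) *\<^sub>R u i) + (x \<bullet> q) *\<^sub>R q + (x \<bullet> a) *\<^sub>R a"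
      by (simp add: y_def algebra_simps)
    then show "(\<Sum>i<Suc (Suc k). (x \<bullet> v i) *\<^sub>R v i) = x" by (simp add: v_def)
  qed simp
  define V where "V = (\<integral>\<^sup>+ t. indicator {x :: real ^ 'n. \<forall>j. 0 \<le> x $ j} (p + (\<Sum>i<k. t i *\<^sub>R u i))
      \<partial>(\<Pi>\<^sub>M i\<in>{..<k}. lborel))"
  have closed_orthant: "closed {x :: real ^ 'n. \<forall>j. 0 \<le> x $ j}"
    by (intro closed_Collect_all closed_Collect_le continuous_intros)
  then have [measurable]: "{x :: real ^ 'n. \<forall>j. 0 \<le> x $ j} \<in> sets borel" by simp
  have vol: "section_vol k a = V"
  proof -
    have eq: "hyperplane a \<inter> simplex_S = E \<inter> {x :: real ^ 'n. \<forall>j. 0 \<le> x $ j}"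
      by (auto simp: E_def hyperplane_def simplex_S_def sum_one_def)
    have "closed E"
    proof -
      have "E = {x. a \<bullet> x = 0} \<inter> {x. one \<bullet> x = 1}" using E by auto
      then show ?thesis by (simp add: closed_hyperplane closed_Int)
    qed
    then have [measurable]: "hyperplane a \<inter> (simplex_S :: (real ^ 'n) set) \<in> sets borel"
      unfolding eq using closed_orthant by (intro borel_closed closed_Int)
    have "section_vol k a = emeasure (distr (\<Pi>\<^sub>M i\<in>{..<k}. lborel) borel (\<lambda>t. p + (\<Sum>i<k. t i *\<^sub>R u i)))
        (hyperplane a \<inter> simplex_S)"
      unfolding section_vol_def affine_lborel_def E_def[symmetric] some by simp
    also have "\<dots> = (\<integral>\<^sup>+ t. indicator (hyperplane a \<inter> simplex_S) (p + (\<Sum>i<k. t i *\<^sub>R u i))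
        \<partial>(\<Pi>\<^sub>M i\<in>{..<k}. lborel))"
      by (subst nn_integral_indicator[symmetric], simp, subst nn_integral_distr) simp_all
    also have "\<dots> = V"
      unfolding V_def eq
    proof (rule nn_integral_cong)
      fix t
      have "p + (\<Sum>i<k. t i *\<^sub>R u i) \<in> E" using Eu by blast
      then show "indicator (E \<inter> {x. \<forall>j. 0 \<le> x $ j}) (p + (\<Sum>i<k. t i *\<^sub>R u i))
          = (indicator {x. \<forall>j. 0 \<le> x $ j} (p + (\<Sum>i<k. t i *\<^sub>R u i)) :: ennreal)"
        by (simp add: indicator_def)
    qed
    finally show ?thesis .
  qed
  define L where "L x = (\<integral>\<^sup>+ t. orthant_exp ((\<Sum>i<k. t i *\<^sub>R u i) + x) \<partial>(\<Pi>\<^sub>M i\<in>{..<k}. lborel))" for x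
  interpret Pk: sigma_finite_measure "\<Pi>\<^sub>M i\<in>{..<k}. lborel :: real measure"
    by (intro sigma_finite_lborel_prod) simp
  have [measurable]: "L \<in> borel_measurable borel" unfolding L_def by measurable
  define d where "d i = (p0 - p) \<bullet> u i" for i
  have d: "p0 - p = (\<Sum>i<k. d i *\<^sub>R u i)"
    unfolding d_def using p p0 by (intro expand) (auto simp: E inner_diff_right)
  \<comment> \<open>The layer of the cone over the section at height \<open>r\<close> is the section dilated
    by \<open>r\<close>.\<close>
  have layer: "L (r *\<^sub>R p0) = ennreal (r ^ k * exp (- r)) * indicator {0..} r * V" if r: "r \<noteq> 0" for r
  proof -
    have "L (r *\<^sub>R p0) = ennreal (\<bar>r\<bar> ^ k) *
        (\<integral>\<^sup>+ t. orthant_exp ((\<Sum>i<k. (- r * d i + r * t i) *\<^sub>R u i) + r *\<^sub>R p0) \<partial>(\<Pi>\<^sub>M i\<in>{..<k}. lborel))"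
      unfolding L_def using nn_integral_lin_comb_affine[of "{..<k}" "\<lambda>x. orthant_exp (x + r *\<^sub>R p0)" r u "\<lambda>i. - r * d i"] r
      by simp
    also have "(\<integral>\<^sup>+ t. orthant_exp ((\<Sum>i<k. (- r * d i + r * t i) *\<^sub>R u i) + r *\<^sub>R p0) \<partial>(\<Pi>\<^sub>M i\<in>{..<k}. lborel))
      = (\<integral>\<^sup>+ t. (ennreal (exp (- r)) * indicator {0..} r) * indicator {x. \<forall>j. 0 \<le> x $ j} (p + (\<Sum>i<k. t i *\<^sub>R u i))
           \<partial>(\<Pi>\<^sub>M i\<in>{..<k}. lborel))"
    proof (rule nn_integral_cong)
      fix t
      define x where "x = p + (\<Sum>i<k. t i *\<^sub>R u i)"
      have x: "one \<bullet> x = 1" using Eu[of x] by (auto simp: E x_def)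
      have "(\<Sum>i<k. (- r * d i + r * t i) *\<^sub>R u i) + r *\<^sub>R p0
          = r *\<^sub>R (p0 - (\<Sum>i<k. d i *\<^sub>R u i) + (\<Sum>i<k. t i *\<^sub>R u i))"
        by (simp add: scaleR_add_left scaleR_add_right scaleR_diff_right sum.distrib sum_subtractf scaleR_sum_right algebra_simps)
      also have "\<dots> = r *\<^sub>R x" unfolding d[symmetric] x_def by simp
      finally have eq: "(\<Sum>i<k. (- r * d i + r * t i) *\<^sub>R u i) + r *\<^sub>R p0 = r *\<^sub>R x" .
      have sum: "(\<Sum>j\<in>UNIV. (r *\<^sub>R x) $ j) = r" using x unfolding one[symmetric] by simp
      show "orthant_exp ((\<Sum>i<k. (- r * d i + r * t i) *\<^sub>R u i) + r *\<^sub>R p0)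
          = (ennreal (exp (- r)) * indicator {0..} r) * indicator {x. \<forall>j. 0 \<le> x $ j} (p + (\<Sum>i<k. t i *\<^sub>R u i))"
      proof (cases "0 < r")
        case True
        then show ?thesis
          unfolding eq x_def[symmetric] orthant_exp_eq sum by (simp add: indicator_def zero_le_mult_iff)
      next
        case False
        then have "r < 0" using r by simp
        moreover have "\<not> (\<forall>j. 0 \<le> (r *\<^sub>R x) $ j)"
          using sum sum_nonneg[of UNIV "\<lambda>j. (r *\<^sub>R x) $ j"] \<open>r < 0\<close> by (metis not_less)
        ultimately show ?thesis unfolding eq orthant_exp_eq by (simp add: indicator_def)
      qed
    qed
    also have "\<dots> = (ennreal (exp (- r)) * indicator {0..} r) * V"
      unfolding V_def by (rule nn_integral_cmult) measurable
    finally show ?thesis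
      by (cases "0 \<le> r") (simp_all add: ennreal_mult' mult_ac)
  qed
  have "comb_dens i (UNIV - {i}) (($) a) 0
      = (\<integral>\<^sup>+ t. slab_exp a i (\<Sum>j\<in>UNIV. t j *\<^sub>R axis j 1) \<partial>(\<Pi>\<^sub>M j\<in>UNIV. lborel))"
    by (rule slab_integral_axes[OF ai, symmetric])
  also have "\<dots> = (\<integral>\<^sup>+ t. slab_exp a i (\<Sum>j<Suc (Suc k). t j *\<^sub>R v j) \<partial>(\<Pi>\<^sub>M j\<in>{..<Suc (Suc k)}. lborel))"
    by (rule nn_integral_orthonormal_basis_unique[OF orthonormal_basis_axis v]) (simp_all add: card)
  also have "\<dots> = (\<integral>\<^sup>+ t. orthant_exp (\<Sum>j<Suc k. t j *\<^sub>R v j) \<partial>(\<Pi>\<^sub>M j\<in>{..<Suc k}. lborel))"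
    by (rule slab_integral_orthonormal[OF ai v]) (simp add: v_def)
  also have "\<dots> = (\<integral>\<^sup>+ r. L (r *\<^sub>R q) \<partial>lborel)"
    using lborel_prod.product_nn_integral_insert_rev[of "{..<k}" k "\<lambda>t. orthant_exp (\<Sum>j<Suc k. t j *\<^sub>R v j)"]
    by (simp add: lessThan_Suc[symmetric] v_def L_def)
  also have "\<dots> = ennreal (1 / J) * (\<integral>\<^sup>+ r. L (r *\<^sub>R p0) \<partial>lborel)"
    using nn_integral_real_affine[of "\<lambda>r. L (r *\<^sub>R q)" "1 / J" 0] J(1) by (simp add: p0_def)
  also have "(\<integral>\<^sup>+ r. L (r *\<^sub>R p0) \<partial>lborel) = (\<integral>\<^sup>+ r. ennreal (r ^ k * exp (- r)) * indicator {0..} r * V \<partial>lborel)"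
    using AE_lborel_singleton[of "0::real"]
    by (intro nn_integral_cong_AE) (auto elim!: eventually_mono simp: layer)
  also have "\<dots> = ennreal (fact k) * V"
    by (subst nn_integral_multc) (simp_all add: nn_intergal_power_times_exp_Ici)
  finally have "ennreal J * comb_dens i (UNIV - {i}) (($) a) 0
      = (ennreal J * ennreal (1 / J)) * (ennreal (fact k) * V)"
    by (simp add: mult.assoc)
  then show ?thesis using J(1) by (simp add: vol J_def[symmetric] ennreal_mult'[symmetric])
qed

section \<open>The bound and its equality case\<close>

lemma comb_dens_union_zero:
  assumes "finite B" "finite A" "A \<inter> B = {}" "\<And>j. j \<in> B \<Longrightarrow> a j = 0"
  shows "comb_dens i (A \<union> B) a = comb_dens i A a"
  using assms by (induction B rule: finite_induct) (simp_all add: comb_dens_insert_zero)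

text \<open>
  The extremal case: with one positive and one nonpositive coefficient the density at \<open>0\<close> is
  an explicit exponential integral.
\<close>

lemma comb_dens_two_point:
  fixes a :: "'n::finite \<Rightarrow> real"
  assumes ij: "i \<noteq> j" and ai: "0 < a i" and aj: "a j \<le> 0" and zero: "\<And>l. l \<noteq> i \<Longrightarrow> l \<noteq> j \<Longrightarrow> a l = 0"
  shows "comb_dens i (UNIV - {i}) a 0 = ennreal (1 / (a i - a j))"
proof -
  \<comment> \<open>The product of the two exponential factors is again exponential, with this
    scale.\<close>
  define l where "l = a i / (a i - a j)"
  have l: "0 < l" using ai aj by (simp add: l_def)
  have "UNIV - {i} = {j} \<union> (UNIV - {i, j})" using ij by auto
  then have "comb_dens i (UNIV - {i}) a = comb_dens i {j} a"
    using comb_dens_union_zero[of "UNIV - {i, j}" "{j}" a i] zero by simp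
  then have "comb_dens i (UNIV - {i}) a 0 = (\<integral>\<^sup>+ t. comb_dens i {} a (0 - a j * t) \<partial>exp_measure)"
    using comb_dens_insert[of "{}" j i a 0] by simp
  also have "\<dots> = (\<integral>\<^sup>+ t. exp_dens t * scaled_exp_dens (a i) (- (a j * t)) \<partial>lborel)"
    unfolding exp_measure_def by (subst nn_integral_density) (simp_all add: comb_dens_def PiM_empty)
  also have "\<dots> = (\<integral>\<^sup>+ t. ennreal (t ^ 0 * (1 / a i * exp (- (1 / l) * t) * indicator {0..} t)) \<partial>lborel)"
  proof (rule nn_integral_cong)
    fix t :: real
    show "exp_dens t * scaled_exp_dens (a i) (- (a j * t))
        = ennreal (t ^ 0 * (1 / a i * exp (- (1 / l) * t) * indicator {0..} t))"
    proof (cases "0 \<le> t")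
      case True
      have "0 \<le> - (a j * t)" using True aj by (simp only: neg_0_le_iff_le mult_nonpos_nonneg)
      then have "0 \<le> - (a j * t) / a i" using ai by (intro divide_nonneg_pos)
      moreover have "exp (- t) * exp (- (- (a j * t) / a i)) = exp (- (1 / l) * t)"
        unfolding mult_exp_exp l_def using ai by (simp add: field_simps)
      ultimately show ?thesis
        using True ai by (simp add: exp_dens_def scaled_exp_dens_def ennreal_mult'[symmetric] mult_ac)
    qed (simp add: exp_dens_def)
  qed
  also have "\<dots> = ennreal (1 / a i * l ^ Suc 0 * fact 0)"
    using scaled_exp_power_integral[OF l, of 0 "1 / a i"] ai
    by (subst nn_integral_eq_integral) (auto simp: has_bochner_integral_iff)
  also have "1 / a i * l ^ Suc 0 * fact 0 = 1 / (a i - a j)"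
    using ai by (simp add: l_def)
  finally show ?thesis .
qed

text \<open>
  With two nonzero coefficients the density is continuous and the one-dimensional inequality
  applies with mean \<open>K\<close> and second moment \<open>K\<^sup>2 + 1\<close>. With only one, \<open>a i = K = 1\<close> and
  the density is the exponential one, discontinuous at \<open>0\<close> but bounded by \<open>1\<close>.
\<close>

theorem comb_dens_bound:
  fixes a :: "'n::finite \<Rightarrow> real"
  assumes sq: "(\<Sum>j\<in>UNIV. (a j)\<^sup>2) = 1" and sum: "(\<Sum>j\<in>UNIV. a j) = K" and K: "0 \<le> K" "K \<le> 1"
    and ai: "a i \<noteq> 0"
  shows "comb_dens i (UNIV - {i}) a 0 \<le> ennreal (1 / sqrt (2 - K\<^sup>2))"
proof (cases "\<exists>j. j \<noteq> i \<and> a j \<noteq> 0")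
  case True
  then obtain j where j: "j \<noteq> i" "a j \<noteq> 0" by blast
  let ?A = "UNIV - {i}"
  define f where "f u = enn2real (comb_dens i ?A a u)" for u
  have A: "finite ?A" "i \<notin> ?A" "insert i ?A = UNIV" by auto
  have pf: "pf2 f"
    unfolding pf2_def
  proof (intro allI impI)
    fix x1 x2 z1 z2 :: real assume "x1 \<le> x2" "z1 \<le> z2"
    then have "comb_dens i ?A a (x1 - z2) * comb_dens i ?A a (x2 - z1)
        \<le> comb_dens i ?A a (x1 - z1) * comb_dens i ?A a (x2 - z2)"
      using pf2_comb_dens[of ?A i a] by (simp add: pf2_def)
    moreover have "comb_dens i ?A a x * comb_dens i ?A a y = ennreal (f x * f y)" for x y
      using comb_dens_eq_ennreal[of ?A i a x] comb_dens_eq_ennreal[of ?A i a y]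
      by (simp add: f_def ennreal_mult)
    ultimately show "f (x1 - z2) * f (x2 - z1) \<le> f (x1 - z1) * f (x2 - z2)"
      by (simp add: f_def)
  qed
  have cont: "continuous_on UNIV f"
    unfolding f_def using j ai by (intro continuous_on_comb_dens[where j = j]) auto
  note moment = comb_dens_moment[OF A(1,2), of a, OF ai, unfolded A(3) f_def[symmetric]]
  have "has_bochner_integral (\<Pi>\<^sub>M j\<in>UNIV :: 'n set. exp_measure) (\<lambda>y. 1) (1 :: real)"
    using exp_prod_integral_prod[of "UNIV :: 'n set" "\<lambda>_ x. x ^ 0" "\<lambda>_. fact 0"] exp_measure_power[of 0]
    by simp
  from moment[of "\<lambda>x. 1", OF _ this] have mass: "has_bochner_integral lborel f 1" by simp
  have mean: "has_bochner_integral lborel (\<lambda>x. x * f x) K"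
    using moment[of "\<lambda>x. x"] exp_prod_comb_moments(1)[of "UNIV :: 'n set" a] sum by simp
  have second: "has_bochner_integral lborel (\<lambda>x. x\<^sup>2 * f x) (K\<^sup>2 + 1)"
    using moment[of "\<lambda>x. x\<^sup>2"] exp_prod_comb_moments(2)[of "UNIV :: 'n set" a] sum sq by simp
  have "K\<^sup>2 \<le> 1" using K by (simp add: abs_square_le_1)
  then have "f 0 \<le> 1 / sqrt (2 * (K\<^sup>2 + 1) - 3 * K\<^sup>2)"
    using K by (intro pf2_density_bound[OF pf cont _ mass mean second]) (auto simp: f_def)
  then have "f 0 \<le> 1 / sqrt (2 - K\<^sup>2)" by (simp add: algebra_simps)
  then show ?thesis
    by (subst comb_dens_eq_ennreal) (simp_all add: f_def ennreal_leI)
next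
  case False
  then have "\<And>j. j \<noteq> i \<Longrightarrow> a j = 0" by blast
  then have "(\<Sum>j\<in>UNIV. (a j)\<^sup>2) = (a i)\<^sup>2" "(\<Sum>j\<in>UNIV. a j) = a i"
    by (subst sum.remove[of _ i]; simp)+
  then have "(a i)\<^sup>2 = 1" "a i = K" using sq sum by auto
  then have "\<bar>a i\<bar> = 1" "K\<^sup>2 = 1" by (auto simp: power2_eq_1_iff)
  then show ?thesis using comb_dens_le[of "UNIV - {i}" i a 0] by simp
qed

lemma section_vol_eq_comb_dens:
  fixes a :: "real ^ 'n" and K :: real
  assumes n: "n \<ge> 1" "CARD('n) = n + 1" and K: "0 \<le> K" "K \<le> 1"
    and a: "norm a = 1" "(\<Sum>j\<in>UNIV. a $ j) = K" and ai: "a $ i \<noteq> 0"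
  shows "section_vol (n - 1) a
     = ennreal (sqrt (real n + 1 - K\<^sup>2) / fact (n - 1)) * comb_dens i (UNIV - {i}) (($) a) 0"
proof -
  have n': "real (n - 1) + 2 = real n + 1" using n(1) by simp
  have K2: "K\<^sup>2 \<le> 1" using K by (simp add: abs_square_le_1)
  have "ennreal (sqrt (real n + 1 - K\<^sup>2)) * comb_dens i (UNIV - {i}) (($) a) 0
      = ennreal (fact (n - 1)) * section_vol (n - 1) a"
    using section_vol_slice[OF a, of "n - 1" i] n K2 ai unfolding n' by simp
  then have "ennreal (1 / fact (n - 1)) * ennreal (sqrt (real n + 1 - K\<^sup>2)) * comb_dens i (UNIV - {i}) (($) a) 0
      = ennreal (1 / fact (n - 1)) * ennreal (fact (n - 1)) * section_vol (n - 1) a"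
    by (simp only: mult.assoc)
  then show ?thesis by (simp add: ennreal_mult'[symmetric])
qed

lemma sum_two_point:
  fixes g :: "'n::finite \<Rightarrow> real"
  assumes "i \<noteq> j" "\<And>l. l \<noteq> i \<Longrightarrow> l \<noteq> j \<Longrightarrow> g l = 0"
  shows "(\<Sum>l\<in>UNIV. g l) = g i + g j"
proof -
  have "(\<Sum>l\<in>UNIV. g l) = (\<Sum>l\<in>{i, j}. g l)"
    using assms by (intro sum.mono_neutral_right) auto
  then show ?thesis using assms(1) by simp
qed

theorem theorem2:
  fixes n :: nat and K :: real
  assumes "n \<ge> 1" and "CARD('n::finite) = n + 1"
    and "0 \<le> K" and "K \<le> 1"
  shows "(\<forall>a :: real ^ 'n. norm a = 1 \<and> (\<Sum>j\<in>UNIV. a $ j) = K \<longrightarrow>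
            section_vol (n - 1) a \<le> ennreal (sqrt (real n + 1 - K\<^sup>2) / fact (n - 1) * (1 / sqrt (2 - K\<^sup>2))))
       \<and> (\<forall>i j :: 'n. i \<noteq> j \<longrightarrow>
            norm (extremal K i j) = 1 \<and> (\<Sum>l\<in>UNIV. extremal K i j $ l) = K \<and>
            section_vol (n - 1) (extremal K i j) =
              ennreal (sqrt (real n + 1 - K\<^sup>2) / fact (n - 1) * (1 / sqrt (2 - K\<^sup>2))))"
proof (intro conjI allI impI)
  have K2: "K\<^sup>2 \<le> 1" using assms(3,4) by (simp add: abs_square_le_1)
  then have n_pos: "0 \<le> sqrt (real n + 1 - K\<^sup>2) / fact (n - 1)" by simp
  have norm_eq: "norm a = 1 \<longleftrightarrow> (\<Sum>j\<in>UNIV. (a $ j)\<^sup>2) = 1" for a :: "real ^ 'n"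
    by (simp add: norm_eq_1 inner_vec_def power2_eq_square)
  {
    fix a :: "real ^ 'n"
    assume a: "norm a = 1 \<and> (\<Sum>j\<in>UNIV. a $ j) = K"
    then have "a \<noteq> 0" by auto
    then obtain i where ai: "a $ i \<noteq> 0" by (auto simp: vec_eq_iff)
    have "comb_dens i (UNIV - {i}) (($) a) 0 \<le> ennreal (1 / sqrt (2 - K\<^sup>2))"
      using a ai assms by (intro comb_dens_bound) (auto simp: norm_eq)
    then have "section_vol (n - 1) a
        \<le> ennreal (sqrt (real n + 1 - K\<^sup>2) / fact (n - 1)) * ennreal (1 / sqrt (2 - K\<^sup>2))"
      using a ai assms by (subst section_vol_eq_comb_dens[where K = K and i = i]) (auto intro: mult_left_mono)
    then show "section_vol (n - 1) a \<le> ennreal (sqrt (real n + 1 - K\<^sup>2) / fact (n - 1) * (1 / sqrt (2 - K\<^sup>2)))"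
      using n_pos by (simp only: ennreal_mult')
  }
  fix i j :: 'n assume ij: "i \<noteq> j"
  define r where "r = sqrt (1 / 2 - K\<^sup>2 / 4)"
  define a where "a = (extremal K i j :: real ^ 'n)"
  have r2: "r\<^sup>2 = 1 / 2 - K\<^sup>2 / 4" "0 \<le> r" using K2 by (auto simp: r_def)
  have a: "a $ i = K / 2 + r" "a $ j = K / 2 - r" "\<And>l. l \<noteq> i \<Longrightarrow> l \<noteq> j \<Longrightarrow> a $ l = 0"
    using ij by (auto simp: a_def extremal_def r_def)
  have "(\<Sum>l\<in>UNIV. (a $ l)\<^sup>2) = (K / 2 + r)\<^sup>2 + (K / 2 - r)\<^sup>2"
    using sum_two_point[OF ij, of "\<lambda>l. (a $ l)\<^sup>2"] a by simp
  also have "\<dots> = K\<^sup>2 / 2 + 2 * r\<^sup>2" by (simp add: power2_eq_square field_simps)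
  finally have norm: "norm a = 1" unfolding norm_eq r2 by simp
  have sum: "(\<Sum>l\<in>UNIV. a $ l) = K"
    using sum_two_point[OF ij, of "\<lambda>l. a $ l"] a by simp
  show "norm (extremal K i j :: real ^ 'n) = 1" "(\<Sum>l\<in>UNIV. (extremal K i j :: real ^ 'n) $ l) = K"
    using norm sum by (simp_all add: a_def)
  have "(K / 2)\<^sup>2 \<le> r\<^sup>2" "0 < r" using K2 r2 by (auto simp: power_divide r_def)
  then have aj: "a $ j \<le> 0" and ai: "0 < a $ i"
    using assms(3) r2(2) a by (auto simp: power2_le_iff_abs_le)
  have "2 * r = sqrt (2 - K\<^sup>2)"
    using r2 by (intro real_sqrt_unique[symmetric]) (auto simp: power_mult_distrib)
  then have "comb_dens i (UNIV - {i}) (($) a) 0 = ennreal (1 / sqrt (2 - K\<^sup>2))"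
    using comb_dens_two_point[OF ij, of "($) a"] ai aj a by simp
  then have "section_vol (n - 1) a
      = ennreal (sqrt (real n + 1 - K\<^sup>2) / fact (n - 1)) * ennreal (1 / sqrt (2 - K\<^sup>2))"
    using section_vol_eq_comb_dens[OF assms norm sum, of i] ai by simp
  then show "section_vol (n - 1) (extremal K i j :: real ^ 'n)
      = ennreal (sqrt (real n + 1 - K\<^sup>2) / fact (n - 1) * (1 / sqrt (2 - K\<^sup>2)))"
    using n_pos by (simp only: a_def ennreal_mult')
qed

end
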